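(* Let $\kappa \in \mathbb{R}$, and let $M$ be a metric space such that every pair of points in $M$ at distance $< D_\kappa$ is connected by a balanced segment. Let $H_p(x,y)$ be a hinge in $M$ with balanced sides $px, py$ and $\operatorname{per}(p,x,y) < 2D_\kappa$. If every hinge $H_{p'}(x',y')$ in $M$ with balanced sides, $\operatorname{per}(p',x',y') < \frac45 \operatorname{per}(p,x,y)$, and $\{x',y'\} \cap (px \cup py) \ne \emptyset$ satisfies (A$_\kappa$), then $H_p(x,y)$ satisfies (A$_\kappa$) as well.
   Context: Let $M$ be a metric space with metric $d$; write $|pq| := d(p,q)$. A segment connecting $p,q \in M$ is the image of an isometric embedding $[0,d(p,q)] \to M$ mapping $0$ to $p$ and $d(p,q)$ to $q$; $pq$ denotes some such segment (not necessarily unique). A hinge $H = H_p(x,y)$ in $M$ consists of three points $p,x,y$ and two nondegenerate segments $px, py$ in $M$ (so $p \notin \{x,y\}$, but possibly $x = y$); $p$ is its vertex, $x,y$ its endpoints, $px,py$ its sides. The perimeter is $\operatorname{per}(H) = \operatorname{per}(p,x,y) := |px|+|py|+|xy|$. $\mathbb{M}^2_\kappa$ is the complete, simply connected surface of constant curvature $\kappa$, and $D_\kappa$ is its diameter: $D_\kappa = \pi/\sqrt{\kappa}$ if $\kappa>0$, $D_\kappa = \infty$ if $\kappa \le 0$. In $\mathbb{M}^2_\kappa$, $\angle_{\bar p}(\bar x,\bar y)$ denotes the usual angle of a hinge. A comparison triple for $(p,x,y)$ is a triple $(\bar p,\bar x,\bar y)$ in $\mathbb{M}^2_\kappa$ with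 $|\bar p\bar x| = |px|$, $|\bar p\bar y| = |py|$, $|\bar x\bar y| = |xy|$ (it exists if $\kappa \le 0$, or if $\kappa>0$ and $\operatorname{per}(p,x,y) \le 2D_\kappa$). For $p \notin \{x,y\}$ (and, if $\kappa>0$, $|px|,|py| < D_\kappa$ and $\operatorname{per}(p,x,y) \le 2D_\kappa$), the comparison angle is $\angle^\kappa_p(x,y) := \angle_{\bar p}(\bar x,\bar y) \in [0,\pi]$. The (upper) angle of a hinge $H_p(x,y)$ in $M$ is $\angle_p(x,y) := \limsup \angle^\kappa_p(u,v)$ as $u \in px$, $v \in py$, $u,v \to p$ ($u,v\neq p$); it is independent of $\kappa$. A hinge $H_p(x,y)$ in $M$ with $\operatorname{per}(p,x,y) < 2D_\kappa$ satisfies (A$_\kappa$) (angle comparison) if $\angle_p(x,y) \ge \angle^\kappa_p(x,y)$. A segment $px$ in $M$ is balanced if, for every nondegenerate segment $qy$ in $M$ with $q \in px \setminus \{p,x\}$, the angles formed by $qy$ and the subsegments $qp, qx$ of $px$ satisfy $\angle_q(p,y) + \angle_q(x,y) = \pi$. *)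

theory Defs
  imports "HOL-Analysis.Analysis"
begin

text \<open>
  The model surface of constant curvature \<open>\<kappa>\<close>, as a subset of \<open>real^3\<close>: the sphere of radius
  \<open>1 / sqrt \<kappa>\<close> for \<open>\<kappa> > 0\<close>, the Euclidean plane \<open>u$3 = 0\<close> for \<open>\<kappa> = 0\<close>, and the upper sheet of
  the hyperboloid \<open>(u$1)^2 + (u$2)^2 - (u$3)^2 = 1 / \<kappa>\<close> in Minkowski space for \<open>\<kappa> < 0\<close>.
\<close>

definition model_form :: "real \<Rightarrow> real^3 \<Rightarrow> real^3 \<Rightarrow> real" where
  "model_form \<kappa> u v = u$1 * v$1 + u$2 * v$2 + sgn \<kappa> * (u$3 * v$3)"

definition model_space :: "real \<Rightarrow> (real^3) set" where
  "model_space \<kappa> =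
     {u. if \<kappa> = 0 then u$3 = 0
         else model_form \<kappa> u u = 1 / \<kappa> \<and> (\<kappa> < 0 \<longrightarrow> u$3 > 0)}"

definition model_dist :: "real \<Rightarrow> real^3 \<Rightarrow> real^3 \<Rightarrow> real" where
  "model_dist \<kappa> u v =
     (if \<kappa> > 0 then arccos (\<kappa> * model_form \<kappa> u v) / sqrt \<kappa>
      else if \<kappa> < 0 then arcosh (\<kappa> * model_form \<kappa> u v) / sqrt (- \<kappa>)
      else dist u v)"

definition model_diameter :: "real \<Rightarrow> ereal" where
  "model_diameter \<kappa> = (if \<kappa> > 0 then ereal (pi / sqrt \<kappa>) else \<infinity>)"

text \<open>
  A positive multiple of the initial velocity at \<open>p\<close> of the geodesic from \<open>p\<close> to \<open>x\<close>, where
  \<open>x \<noteq> p\<close> and \<open>x \<noteq> -p\<close>.  E.g. for \<open>\<kappa> > 0\<close> the unit speed geodesic with initial velocity \<open>e\<close> is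
  \<open>t \<mapsto> cos (sqrt \<kappa> * t) *\<^sub>R p + (sin (sqrt \<kappa> * t) / sqrt \<kappa>) *\<^sub>R e\<close>, and
  \<open>cos (sqrt \<kappa> * t) = \<kappa> * model_form \<kappa> p x\<close> when it reaches \<open>x\<close>.  For \<open>\<kappa> < 0\<close>, the form
  \<open>model_form \<kappa>\<close> is positive definite on the tangent plane at \<open>p\<close>.
\<close>

definition model_direction :: "real \<Rightarrow> real^3 \<Rightarrow> real^3 \<Rightarrow> real^3" where
  "model_direction \<kappa> p x = (if \<kappa> = 0 then x - p else x - (\<kappa> * model_form \<kappa> p x) *\<^sub>R p)"

definition model_angle :: "real \<Rightarrow> real^3 \<Rightarrow> real^3 \<Rightarrow> real^3 \<Rightarrow> real" where
  "model_angle \<kappa> p x y =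
     (let u = model_direction \<kappa> p x; v = model_direction \<kappa> p y
      in arccos (model_form \<kappa> u v / (sqrt (model_form \<kappa> u u) * sqrt (model_form \<kappa> v v))))"

definition comparison_triple ::
    "real \<Rightarrow> 'a::metric_space \<Rightarrow> 'a \<Rightarrow> 'a \<Rightarrow> real^3 \<Rightarrow> real^3 \<Rightarrow> real^3 \<Rightarrow> bool" where
  "comparison_triple \<kappa> p x y p' x' y' \<longleftrightarrow>
     p' \<in> model_space \<kappa> \<and> x' \<in> model_space \<kappa> \<and> y' \<in> model_space \<kappa> \<and>
     model_dist \<kappa> p' x' = dist p x \<and> model_dist \<kappa> p' y' = dist p y \<and>
     model_dist \<kappa> x' y' = dist x y"

text \<open>
  Meaningful only for \<open>p \<noteq> x\<close>, \<open>p \<noteq> y\<close> and, if \<open>\<kappa> > 0\<close>, for \<open>dist p x\<close> and \<open>dist p y\<close> less than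
  \<open>model_diameter \<kappa>\<close> and perimeter at most \<open>2 * model_diameter \<kappa>\<close>; then a comparison triple
  exists and its angle does not depend on the choice.
\<close>

definition comparison_angle :: "real \<Rightarrow> 'a::metric_space \<Rightarrow> 'a \<Rightarrow> 'a \<Rightarrow> real" where
  "comparison_angle \<kappa> p x y =
     (THE \<alpha>. \<exists>p' x' y'. comparison_triple \<kappa> p x y p' x' y' \<and> \<alpha> = model_angle \<kappa> p' x' y')"

definition segment :: "'a::metric_space \<Rightarrow> 'a \<Rightarrow> 'a set \<Rightarrow> bool" where
  "segment p q S \<longleftrightarrow>
     (\<exists>\<gamma>::real \<Rightarrow> 'a.
        (\<forall>s\<in>{0..dist p q}. \<forall>t\<in>{0..dist p q}. dist (\<gamma> s) (\<gamma> t) = \<bar>s - t\<bar>) \<and>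
        \<gamma> 0 = p \<and> \<gamma> (dist p q) = q \<and> S = \<gamma> ` {0..dist p q})"

definition hinge :: "'a::metric_space \<Rightarrow> 'a \<Rightarrow> 'a \<Rightarrow> 'a set \<Rightarrow> 'a set \<Rightarrow> bool" where
  "hinge p x y S T \<longleftrightarrow> p \<noteq> x \<and> p \<noteq> y \<and> segment p x S \<and> segment p y T"

definition perimeter :: "'a::metric_space \<Rightarrow> 'a \<Rightarrow> 'a \<Rightarrow> real" where
  "perimeter p x y = dist p x + dist p y + dist x y"

text \<open>
  The upper angle at \<open>p\<close> between segments \<open>S\<close> and \<open>T\<close> issuing from \<open>p\<close>.  Its value does not
  depend on \<open>\<kappa>\<close>, which is merely the curvature of the model surface used to compute it.
\<close>

definition upper_angle :: "real \<Rightarrow> 'a::metric_space \<Rightarrow> 'a set \<Rightarrow> 'a set \<Rightarrow> real" where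
  "upper_angle \<kappa> p S T =
     real_of_ereal (Limsup ((at p within S) \<times>\<^sub>F (at p within T))
       (\<lambda>(u, v). ereal (comparison_angle \<kappa> p u v)))"

definition angle_comparison ::
    "real \<Rightarrow> 'a::metric_space \<Rightarrow> 'a \<Rightarrow> 'a \<Rightarrow> 'a set \<Rightarrow> 'a set \<Rightarrow> bool" where
  "angle_comparison \<kappa> p x y S T \<longleftrightarrow> upper_angle \<kappa> p S T \<ge> comparison_angle \<kappa> p x y"

text \<open>Here \<open>P\<close> and \<open>X\<close> are the two subsegments into which \<open>q\<close> divides \<open>S\<close>.\<close>

definition balanced_segment :: "real \<Rightarrow> 'a::metric_space \<Rightarrow> 'a \<Rightarrow> 'a set \<Rightarrow> bool" where
  "balanced_segment \<kappa> p x S \<longleftrightarrow>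
     segment p x S \<and>
     (\<forall>q y T P X. q \<in> S - {p, x} \<longrightarrow> q \<noteq> y \<longrightarrow> segment q y T \<longrightarrow>
        segment q p P \<longrightarrow> P \<subseteq> S \<longrightarrow> segment q x X \<longrightarrow> X \<subseteq> S \<longrightarrow>
        upper_angle \<kappa> q P T + upper_angle \<kappa> q X T = pi)"

end

theory Submission imports Defs begin

text \<open>
  Let \<open>md\<close> be the function of the distance in which the cosine law of the model surface is affine
  in the cosine of the angle.  The comparison (A) for a hinge with sides \<open>a\<close>, \<open>b\<close> and angle \<open>\<alpha>\<close>
  says that \<open>md\<close> of the distance of its endpoints is at most \<open>md\<close> of the third side
  \<open>m(a, b, \<alpha>)\<close> of the model hinge.

  If \<open>q'\<close> is an interior point of the side \<open>qy\<close> of a hinge \<open>H_q(x, y)\<close>, and (A) holds for the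
  hinges \<open>H_q(x, q')\<close> and \<open>H_q'(x, q)\<close>, then balancedness at \<open>q'\<close> shows that the model side
  decreases when \<open>H_q(x, y)\<close> is replaced by \<open>H_q'(x, y)\<close>; thus (A) for the latter hinge implies (A)
  for the former.

  Let \<open>P\<close> be the perimeter of \<open>H_p(x, y)\<close>.  Consider a hinge \<open>H_q(u, v)\<close> whose endpoints lie on
  the sides of \<open>H_p(x, y)\<close> and whose sides have a sum \<open>s < 4/5 P\<close>.  Sliding \<open>q\<close> by a constant
  amount along the longer side only involves auxiliary hinges of perimeter less than \<open>4/5 P\<close>.
  If (A) failed for \<open>H_q(u, v)\<close>, it would fail by at least the same amount after each
  such step, while \<open>s\<close> would drop by a fixed amount each time, because almost no drop
  means that the model side is almost \<open>s\<close>.  So (A) holds for \<open>H_q(u, v)\<close>.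

  If the sides of \<open>H_p(x, y)\<close> have a sum of at least \<open>4/5 P\<close> and \<open>px\<close> is the shorter one, then
  dividing \<open>px\<close> at distance \<open>P/5\<close> from \<open>p\<close> yields three hinges of the kind just treated.
\<close>

section \<open>Trigonometry of the model surface\<close>

text \<open>The antiderivative of \<open>sn \<kappa>\<close> that vanishes at 0, often called the
  modified distance. Division by \<kappa> normalizes it so that it tends to
  \<open>t\<^sup>2 / 2\<close> as \<kappa> tends to 0.\<close>

definition md :: "real \<Rightarrow> real \<Rightarrow> real" where
  "md \<kappa> t = (if \<kappa> = 0 then t\<^sup>2 / 2
     else if \<kappa> > 0 then (1 - cos (sqrt \<kappa> * t)) / \<kappa> else (1 - cosh (sqrt (- \<kappa>) * t)) / \<kappa>)"

definition sn :: "real \<Rightarrow> real \<Rightarrow> real" where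
  "sn \<kappa> t = (if \<kappa> = 0 then t
     else if \<kappa> > 0 then sin (sqrt \<kappa> * t) / sqrt \<kappa> else sinh (sqrt (- \<kappa>) * t) / sqrt (- \<kappa>))"

text \<open>Written through \<open>md\<close> instead of by cases, so that the addition formulas
  become polynomial identities in \<open>md\<close> and \<open>sn\<close> for every sign of
  \<kappa>.\<close>

definition cs :: "real \<Rightarrow> real \<Rightarrow> real" where
  "cs \<kappa> t = 1 - \<kappa> * md \<kappa> t"

definition within_diam :: "real \<Rightarrow> real \<Rightarrow> bool" where
  "within_diam \<kappa> t \<longleftrightarrow> (\<kappa> > 0 \<longrightarrow> t < pi / sqrt \<kappa>)"

lemma cs_pos_curv: "\<kappa> > 0 \<Longrightarrow> cs \<kappa> t = cos (sqrt \<kappa> * t)"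
  by (simp add: cs_def md_def)

lemma cs_neg_curv: "\<kappa> < 0 \<Longrightarrow> cs \<kappa> t = cosh (sqrt (- \<kappa>) * t)"
  by (simp add: cs_def md_def)

lemma sn_diff: "sn \<kappa> (a - b) = sn \<kappa> a * cs \<kappa> b - cs \<kappa> a * sn \<kappa> b"
  by (cases "\<kappa> = 0"; cases "\<kappa> > 0")
     (auto simp: cs_def sn_def md_def field_simps sin_diff sinh_diff)

lemma md_add: "md \<kappa> (a + b) = md \<kappa> a + cs \<kappa> a * md \<kappa> b + sn \<kappa> a * sn \<kappa> b"
proof -
  consider "\<kappa> = 0" | "\<kappa> > 0" | "\<kappa> < 0" by linarith
  then show ?thesis
  proof cases
    case 1 then show ?thesis by (simp add: cs_def sn_def md_def power2_eq_square field_simps)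
  next
    case 2
    then have "sqrt \<kappa> * sqrt \<kappa> = \<kappa>" by simp
    with 2 show ?thesis by (simp add: cs_def sn_def md_def distrib_left cos_add field_simps)
  next
    case 3
    then have "sqrt (-\<kappa>) * sqrt (-\<kappa>) = -\<kappa>" by simp
    with 3 show ?thesis by (simp add: cs_def sn_def md_def distrib_left cosh_add field_simps)
  qed
qed

lemma md_0 [simp]: "md \<kappa> 0 = 0"
  by (simp add: md_def)

lemma md_minus [simp]: "md \<kappa> (- t) = md \<kappa> t"
  by (simp add: md_def)

lemma sn_minus [simp]: "sn \<kappa> (- t) = - sn \<kappa> t"
  by (simp add: sn_def)

lemma md_abs: "md \<kappa> \<bar>t\<bar> = md \<kappa> t"
  by (simp add: abs_if)

lemma md_diff: "md \<kappa> (a - b) = md \<kappa> a + cs \<kappa> a * md \<kappa> b - sn \<kappa> a * sn \<kappa> b"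
  using md_add[of \<kappa> a "-b"] by simp

text \<open>Expanding \<open>md \<kappa> (t - t) = 0\<close> gives the Pythagorean identity without
  a case split on \<kappa>.\<close>

lemma sn_square: "(sn \<kappa> t)\<^sup>2 = md \<kappa> t * (2 - \<kappa> * md \<kappa> t)"
  using md_diff[of \<kappa> t t] by (simp add: cs_def power2_eq_square algebra_simps)

lemma cs_add: "cs \<kappa> (a + b) = cs \<kappa> a * cs \<kappa> b - \<kappa> * (sn \<kappa> a * sn \<kappa> b)"
  by (simp add: cs_def md_add algebra_simps)

lemma cs_square: "\<kappa> * (sn \<kappa> t)\<^sup>2 + (cs \<kappa> t)\<^sup>2 = 1"
  unfolding sn_square cs_def by (simp add: power2_eq_square algebra_simps)

lemma sn_pos: "0 < t \<Longrightarrow> within_diam \<kappa> t \<Longrightarrow> 0 < sn \<kappa> t"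
  by (auto simp: sn_def within_diam_def field_simps intro!: sin_gt_zero divide_pos_pos)

lemma has_real_derivative_md: "(md \<kappa> has_real_derivative sn \<kappa> t) (at t)"
proof -
  consider "\<kappa> = 0" | "\<kappa> > 0" | "\<kappa> < 0" by linarith
  then show ?thesis
  proof cases
    case 1 then show ?thesis unfolding md_def[abs_def] sn_def by (auto intro!: derivative_eq_intros)
  next
    case 2
    then have "sqrt \<kappa> * sqrt \<kappa> = \<kappa>" by simp
    with 2 show ?thesis unfolding md_def[abs_def] sn_def
      by (auto intro!: derivative_eq_intros simp: field_simps)
  next
    case 3
    then have "sqrt (- \<kappa>) / \<kappa> = - (1 / sqrt (- \<kappa>))"
      by (simp add: field_simps)
    with 3 show ?thesis unfolding md_def[abs_def] sn_def
      by (auto intro!: derivative_eq_intros simp: field_simps simp flip: mult.assoc)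
  qed
qed

lemma continuous_on_sn: "continuous_on A (sn \<kappa>)"
  unfolding sn_def[abs_def] by (cases "\<kappa> = 0"; cases "\<kappa> > 0") (simp_all add: continuous_intros)

text \<open>The difference is a product of \<open>sn\<close> at half the sum and \<open>sn\<close>
  at half the difference, both nonnegative. Only the sum s + t is bounded, because t will be the sum
  of two sides of a triangle, which may exceed \<open>D_\<kappa>\<close>.\<close>

lemma md_mono:
  assumes "0 \<le> s" "s \<le> t" "\<kappa> > 0 \<longrightarrow> s + t \<le> 2 * (pi / sqrt \<kappa>)"
  shows "md \<kappa> s \<le> md \<kappa> t"
proof -
  have nonneg: "0 \<le> sn \<kappa> r" if "0 \<le> r" "2 * r \<le> s + t" for r
  proof (cases "\<kappa> > 0")
    case True
    then have "r \<le> pi / sqrt \<kappa>" using that assms(3) by simp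
    with True that show ?thesis
      by (auto simp: sn_def field_simps intro!: sin_ge_zero divide_nonneg_nonneg)
  qed (use that in \<open>auto simp: sn_def\<close>)
  have "md \<kappa> t - md \<kappa> s = 2 * sn \<kappa> ((s + t) / 2) * sn \<kappa> ((t - s) / 2)"
    using md_add[of \<kappa> "(s + t) / 2" "(t - s) / 2"] md_diff[of \<kappa> "(s + t) / 2" "(t - s) / 2"]
    by (simp add: field_simps)
  moreover have "0 \<le> 2 * sn \<kappa> ((s + t) / 2) * sn \<kappa> ((t - s) / 2)"
    using assms by (intro mult_nonneg_nonneg nonneg) auto
  ultimately show ?thesis by linarith
qed

text \<open>\<open>law_cos\<close> is the cosine of the angle opposite to \<open>c\<close> in a model triangle with sides \<open>a\<close>, \<open>b\<close>,
  \<open>c\<close>; \<open>hinge_md\<close> is \<open>md\<close> of the third side of a model hinge with sides \<open>a\<close>, \<open>b\<close> and angle \<open>\<alpha>\<close>.\<close>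

definition law_cos :: "real \<Rightarrow> real \<Rightarrow> real \<Rightarrow> real \<Rightarrow> real" where
  "law_cos \<kappa> a b c = (md \<kappa> (a + b) - md \<kappa> c) / (sn \<kappa> a * sn \<kappa> b) - 1"

definition hinge_md :: "real \<Rightarrow> real \<Rightarrow> real \<Rightarrow> real \<Rightarrow> real" where
  "hinge_md \<kappa> a b \<alpha> = md \<kappa> (a + b) - sn \<kappa> a * sn \<kappa> b * (1 + cos \<alpha>)"

lemma hinge_md_commute: "hinge_md \<kappa> a b \<alpha> = hinge_md \<kappa> b a \<alpha>"
  by (simp add: hinge_md_def add.commute mult.commute)

text \<open>The angle 0 gives the least third side \<bar>a - b\<bar>; the surplus is
  \<open>sn \<kappa> a * sn \<kappa> b * (1 - cos \<alpha>)\<close>.\<close>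

lemma hinge_md_ge:
  assumes "0 \<le> sn \<kappa> a" "0 \<le> sn \<kappa> b"
  shows "md \<kappa> (a - b) \<le> hinge_md \<kappa> a b \<alpha>"
proof -
  have "0 \<le> sn \<kappa> a * sn \<kappa> b * (1 - cos \<alpha>)" using assms by simp
  then show ?thesis unfolding hinge_md_def md_add md_diff by (simp add: algebra_simps)
qed

text \<open>The extreme values -1 and 1 are attained for c = a + b and c = \<bar>a - b\<bar>, and
  \<open>md\<close> is monotone in between.\<close>

lemma law_cos_bounds:
  assumes "0 < a" "0 < b" "\<bar>a - b\<bar> \<le> c" "c \<le> a + b"
    and "\<kappa> > 0 \<longrightarrow> a < pi / sqrt \<kappa> \<and> b < pi / sqrt \<kappa> \<and> a + b + c \<le> 2 * (pi / sqrt \<kappa>)"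
  shows "\<bar>law_cos \<kappa> a b c\<bar> \<le> 1"
proof -
  have pos: "0 < sn \<kappa> a * sn \<kappa> b"
    using assms by (intro mult_pos_pos sn_pos) (auto simp: within_diam_def)
  have "md \<kappa> c \<le> md \<kappa> (a + b)" using assms by (intro md_mono) auto
  moreover have "md \<kappa> \<bar>a - b\<bar> \<le> md \<kappa> c" using assms by (intro md_mono) auto
  then have "md \<kappa> (a + b) - md \<kappa> c \<le> 2 * (sn \<kappa> a * sn \<kappa> b)"
    unfolding md_abs md_diff md_add by simp
  ultimately show ?thesis using pos by (simp add: law_cos_def field_simps abs_le_iff)
qed

text \<open>In a model triangle with base \<open>t\<close> and legs \<open>a\<close>, \<open>c\<close>, both sides are \<open>sn \<kappa> t * md \<kappa> d\<close>, where
  \<open>d\<close> is the distance of the apex from the point at position \<open>b\<close> on the line through the base,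
  computed from the angle at either end of the base.\<close>

lemma stewart:
  "sn \<kappa> t * md \<kappa> (a + b) - sn \<kappa> b * (md \<kappa> (a + t) - md \<kappa> c) =
   sn \<kappa> t * md \<kappa> (c + (b - t)) - sn \<kappa> (b - t) * (md \<kappa> a - md \<kappa> (c - t))"
proof -
  have st: "sn \<kappa> t * sn \<kappa> t = md \<kappa> t * (2 - \<kappa> * md \<kappa> t)"
    using sn_square[of \<kappa> t] by (simp add: power2_eq_square)
  show ?thesis
    \<comment> \<open>After expansion, both sides are polynomials in \<open>md\<close> and
      \<open>sn\<close> of a, b, c, t, and they agree modulo the Pythagorean relation for t.\<close>
    unfolding md_add md_diff sn_diff cs_def using st by algebra
qed

section \<open>Comparison angles\<close>

text \<open>Here the form is the Euclidean inner product, so this is Cauchy-Schwarz. It keeps the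
  argument of \<open>arccos\<close> in \<open>model_dist\<close> inside its domain.\<close>

lemma model_form_bounds_pos:
  assumes "\<kappa> > 0" "u \<in> model_space \<kappa>" "v \<in> model_space \<kappa>"
  shows "\<bar>\<kappa> * model_form \<kappa> u v\<bar> \<le> 1"
proof -
  have form: "model_form \<kappa> a b = a \<bullet> b" for a b
    using assms(1) by (simp add: model_form_def inner_vec_def sum_3)
  have "u \<bullet> u = 1 / \<kappa>" "v \<bullet> v = 1 / \<kappa>"
    using assms by (auto simp: model_space_def form)
  then have "\<bar>u \<bullet> v\<bar> \<le> sqrt (1 / \<kappa>) * sqrt (1 / \<kappa>)"
    using Cauchy_Schwarz_ineq2[of u v] by (simp add: norm_eq_sqrt_inner)
  then have "\<bar>u \<bullet> v\<bar> \<le> 1 / \<kappa>" using assms(1) by simp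
  then show ?thesis using assms(1) by (simp add: form abs_mult field_simps)
qed

lemma model_form_bounds_neg:
  assumes "\<kappa> < 0" "u \<in> model_space \<kappa>" "v \<in> model_space \<kappa>"
  shows "1 \<le> \<kappa> * model_form \<kappa> u v"
proof -
  define k where "k = 1 / - \<kappa>"
  have k: "k > 0" "\<kappa> * k = -1" using assms(1) by (auto simp: k_def)
  have u: "(u$3)\<^sup>2 = (sqrt k)\<^sup>2 + (u$1)\<^sup>2 + (u$2)\<^sup>2" "u$3 > 0"
    and v: "(v$3)\<^sup>2 = (sqrt k)\<^sup>2 + (v$1)\<^sup>2 + (v$2)\<^sup>2" "v$3 > 0"
    using assms k(1) by (auto simp: model_space_def model_form_def k_def power2_eq_square)
  \<comment> \<open>By the hyperboloid equation \<open>u$3\<close> and \<open>v$3\<close> are the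
    Euclidean norms of these vectors, which reduces the reversed Cauchy-Schwarz inequality to the
    ordinary one.\<close>
  let ?a = "vector [sqrt k, u$1, u$2] :: real^3" and ?b = "vector [sqrt k, v$1, v$2] :: real^3"
  have "norm ?a = u$3" "norm ?b = v$3"
    using u v by (simp_all add: norm_eq_sqrt_inner inner_vec_def sum_3 real_sqrt_unique
        flip: power2_eq_square)
  with norm_cauchy_schwarz[of ?a ?b] have "k + u$1 * v$1 + u$2 * v$2 \<le> u$3 * v$3"
    using k(1) by (simp add: inner_vec_def sum_3)
  then have "\<kappa> * (u$3 * v$3) \<le> \<kappa> * (k + u$1 * v$1 + u$2 * v$2)"
    using assms(1) by simp
  then show ?thesis using assms(1) k(2) by (simp add: model_form_def algebra_simps)
qed

lemma model_form_eq_cs: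
  assumes "\<kappa> \<noteq> 0" "u \<in> model_space \<kappa>" "v \<in> model_space \<kappa>"
  shows "\<kappa> * model_form \<kappa> u v = cs \<kappa> (model_dist \<kappa> u v)"
proof (cases "\<kappa> > 0")
  case True
  then show ?thesis
    using model_form_bounds_pos[OF True assms(2,3)]
    by (simp add: cs_pos_curv model_dist_def abs_le_iff cos_arccos)
next
  case False
  then have "\<kappa> < 0" using assms(1) by simp
  then show ?thesis
    using model_form_bounds_neg[OF _ assms(2,3)]
    by (simp add: cs_neg_curv model_dist_def)
qed

lemma model_dist_eqI:
  assumes "\<kappa> \<noteq> 0" "\<kappa> * model_form \<kappa> u v = cs \<kappa> r" "0 \<le> r" "\<kappa> > 0 \<longrightarrow> r \<le> pi / sqrt \<kappa>"
  shows "model_dist \<kappa> u v = r"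
proof (cases "\<kappa> > 0")
  case True
  with assms have "sqrt \<kappa> * r \<le> pi" by (simp add: field_simps)
  with True assms show ?thesis by (simp add: model_dist_def cs_pos_curv arccos_cos)
next
  case False
  then have "\<kappa> < 0" using assms(1) by simp
  with assms show ?thesis by (simp add: model_dist_def cs_neg_curv arcosh_cosh_real)
qed

text \<open>The cosine law: the angle is determined by the three side lengths, which makes the
  definite description in \<open>comparison_angle\<close> independent of the chosen triple.\<close>

lemma model_angle_eq:
  fixes \<kappa> :: real and u v w :: "real^3"
  defines "a \<equiv> model_dist \<kappa> u v" and "b \<equiv> model_dist \<kappa> u w" and "c \<equiv> model_dist \<kappa> v w"
  assumes "u \<in> model_space \<kappa>" "v \<in> model_space \<kappa>" "w \<in> model_space \<kappa>"
    and pos: "0 < a" "0 < b" "within_diam \<kappa> a" "within_diam \<kappa> b"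
  shows "model_angle \<kappa> u v w = arccos (law_cos \<kappa> a b c)"
proof (cases "\<kappa> = 0")
  case True
  let ?v = "v - u" and ?w = "w - u"
  have c: "c\<^sup>2 = norm (?v - ?w)^2" and a: "a = norm ?v" and b: "b = norm ?w"
    using True by (simp_all add: a_def b_def c_def model_dist_def dist_norm norm_minus_commute)
  have "u$3 = 0" "v$3 = 0" "w$3 = 0" using assms True by (auto simp: model_space_def)
  then have form: "model_form \<kappa> s t = s \<bullet> t" if "s \<in> {?v, ?w}" "t \<in> {?v, ?w}" for s t
    using that True by (auto simp: model_form_def inner_vec_def sum_3)
  have "(a\<^sup>2 + b\<^sup>2 - c\<^sup>2) / 2 = ?v \<bullet> ?w"
    unfolding a b c power2_norm_eq_inner by (simp add: inner_diff inner_commute)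
  moreover have "md \<kappa> (a + b) - md \<kappa> c = a * b + (a\<^sup>2 + b\<^sup>2 - c\<^sup>2) / 2"
    using True by (simp add: md_def power2_eq_square field_simps)
  ultimately have "law_cos \<kappa> a b c = (?v \<bullet> ?w) / (a * b)"
    using True pos by (simp add: law_cos_def sn_def add_divide_distrib)
  then show ?thesis
    unfolding model_angle_def model_direction_def Let_def
    by (simp add: True form[unfolded True] a b norm_eq_sqrt_inner)
next
  case False
  have form: "model_form \<kappa> u v = cs \<kappa> a / \<kappa>" "model_form \<kappa> u w = cs \<kappa> b / \<kappa>"
    "model_form \<kappa> v w = cs \<kappa> c / \<kappa>"
    using False assms by (simp_all add: model_form_eq_cs[symmetric])
  have self: "model_form \<kappa> z z = 1 / \<kappa>" if "z \<in> model_space \<kappa>" for z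
    using that False by (simp add: model_space_def)
  have dir: "model_form \<kappa> (model_direction \<kappa> u y) (model_direction \<kappa> u z) =
      model_form \<kappa> y z - \<kappa> * model_form \<kappa> u y * model_form \<kappa> u z" for y z
  proof -
    have "model_form \<kappa> (model_direction \<kappa> u y) (model_direction \<kappa> u z) =
      model_form \<kappa> y z - 2 * \<kappa> * model_form \<kappa> u y * model_form \<kappa> u z
      + \<kappa>\<^sup>2 * model_form \<kappa> u y * model_form \<kappa> u z * model_form \<kappa> u u"
      using False by (simp add: model_form_def model_direction_def power2_eq_square algebra_simps)
    then show ?thesis using False by (simp add: self assms power2_eq_square)
  qed
  \<comment> \<open>The length of \<open>model_direction \<kappa> u z\<close>, where r is the
    distance from u to z.\<close>
  have sn: "sqrt (1 / \<kappa> - \<kappa> * (cs \<kappa> r / \<kappa>) * (cs \<kappa> r / \<kappa>)) = sn \<kappa> r"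
    if "0 < r" "within_diam \<kappa> r" for r
  proof -
    have "1 / \<kappa> - \<kappa> * (cs \<kappa> r / \<kappa>) * (cs \<kappa> r / \<kappa>) = (sn \<kappa> r)\<^sup>2"
      using cs_square[of \<kappa> r] False by (simp add: field_simps power2_eq_square)
    then show ?thesis using sn_pos[OF that] by simp
  qed
  have "law_cos \<kappa> a b c = (cs \<kappa> c / \<kappa> - \<kappa> * (cs \<kappa> a / \<kappa>) * (cs \<kappa> b / \<kappa>)) / (sn \<kappa> a * sn \<kappa> b)"
  proof -
    have pos': "sn \<kappa> a * sn \<kappa> b \<noteq> 0" using pos by (simp add: sn_pos less_imp_neq[symmetric])
    have "md \<kappa> (a + b) - md \<kappa> c = (cs \<kappa> c - cs \<kappa> (a + b)) / \<kappa>"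
      using False by (simp add: cs_def diff_divide_distrib)
    also have "\<dots> = cs \<kappa> c / \<kappa> - \<kappa> * (cs \<kappa> a / \<kappa>) * (cs \<kappa> b / \<kappa>) + sn \<kappa> a * sn \<kappa> b"
      unfolding cs_add using False by (simp add: field_simps)
    finally show ?thesis using pos' unfolding law_cos_def by (simp add: add_divide_distrib)
  qed
  then show ?thesis
    unfolding model_angle_def Let_def dir form self[OF assms(5)] self[OF assms(6)]
      sn[OF pos(1,3)] sn[OF pos(2,4)] by simp
qed

text \<open>An explicit triple: the vertex at the origin or the pole, the first endpoint over the
  first axis, and the second one over the direction (g, h), where g is the cosine prescribed by the
  cosine law and h the matching sine.\<close>

lemma comparison_triple_exists:
  fixes p x y :: "'a::metric_space"
  assumes "p \<noteq> x" "p \<noteq> y"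
    and diam: "\<kappa> > 0 \<longrightarrow>
      dist p x < pi / sqrt \<kappa> \<and> dist p y < pi / sqrt \<kappa> \<and> perimeter p x y \<le> 2 * (pi / sqrt \<kappa>)"
  shows "\<exists>p' x' y'. comparison_triple \<kappa> p x y p' x' y'"
proof -
  define a b c where abc: "a = dist p x" "b = dist p y" "c = dist x y"
  have ab: "0 < a" "0 < b" using assms by (auto simp: abc)
  have tri: "\<bar>a - b\<bar> \<le> c" "c \<le> a + b"
    using dist_triangle3[of x y p] dist_triangle2[of p x y] dist_triangle[of p y x]
    by (auto simp: abc dist_commute)
  define g where "g = law_cos \<kappa> a b c"
  define h where "h = sqrt (1 - g\<^sup>2)"
  have "\<bar>g\<bar> \<le> 1" unfolding g_def
    by (rule law_cos_bounds) (use ab tri diam in \<open>auto simp: abc perimeter_def\<close>)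
  then have gh: "h * h = 1 - g * g"
    by (simp add: h_def abs_square_le_1 flip: power2_eq_square)
  have snn: "sn \<kappa> a * sn \<kappa> b > 0"
    using ab diam by (intro mult_pos_pos sn_pos) (auto simp: within_diam_def abc)
  have md_c: "md \<kappa> c = md \<kappa> (a + b) - (1 + g) * (sn \<kappa> a * sn \<kappa> b)"
    using less_imp_neq[OF snn, symmetric] unfolding g_def law_cos_def by (simp del: mult_eq_0_iff)
  show ?thesis
  proof (cases "\<kappa> = 0")
    case True
    let ?p = "0 :: real^3" and ?x = "vector [a, 0, 0] :: real^3"
      and ?y = "vector [g * b, h * b, 0] :: real^3"
    have "(dist ?x ?y)\<^sup>2 = a\<^sup>2 + b\<^sup>2 * (g * g + h * h) - 2 * a * b * g"
      unfolding dist_norm power2_norm_eq_inner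
      by (simp add: inner_vec_def sum_3 power2_eq_square algebra_simps)
    also have "\<dots> = c\<^sup>2"
      using md_c True unfolding gh by (simp add: md_def sn_def power2_eq_square algebra_simps)
    finally have xy: "dist ?x ?y = c" by (rule power2_eq_imp_eq) (auto simp: abc)
    have "(norm ?y)\<^sup>2 = b\<^sup>2 * (g * g + h * h)"
      unfolding power2_norm_eq_inner
      by (simp add: inner_vec_def sum_3 power2_eq_square algebra_simps)
    also have "\<dots> = b\<^sup>2" unfolding gh by simp
    finally have y: "norm ?y = b" by (rule power2_eq_imp_eq) (use ab in simp_all)
    have "norm ?x = a"
      using ab by (simp add: norm_eq_sqrt_inner inner_vec_def sum_3)
    with xy y have "comparison_triple \<kappa> p x y ?p ?x ?y"
      using True by (simp add: comparison_triple_def model_space_def model_dist_def abc)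
    then show ?thesis by blast
  next
    case False
    \<comment> \<open>Rescaling the third coordinate by m lets the same formulas describe points of
      the sphere and of the hyperboloid.\<close>
    define m where "m = sqrt \<bar>\<kappa>\<bar>"
    have m: "m > 0" "\<kappa> * sgn \<kappa> = m * m"
      using False by (auto simp: m_def sgn_if)
    let ?p = "vector [0, 0, 1 / m] :: real^3" and ?x = "vector [sn \<kappa> a, 0, cs \<kappa> a / m] :: real^3"
      and ?y = "vector [g * sn \<kappa> b, h * sn \<kappa> b, cs \<kappa> b / m] :: real^3"
    have form: "\<kappa> * model_form \<kappa> u v = \<kappa> * (u$1 * v$1 + u$2 * v$2) + (u$3 * m) * (v$3 * m)" for u v
      by (simp add: model_form_def distrib_left flip: m(2))
    have cs_nonneg: "\<kappa> < 0 \<longrightarrow> cs \<kappa> r > 0" for r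
      by (simp add: cs_neg_curv)
    have memI: "u \<in> model_space \<kappa>" if "\<kappa> * model_form \<kappa> u u = 1" "\<kappa> < 0 \<longrightarrow> u$3 > 0" for u
      using that False by (simp add: model_space_def field_simps)
    have sq: "\<kappa> * (sn \<kappa> r * sn \<kappa> r) + cs \<kappa> r * cs \<kappa> r = 1" for r
      using cs_square[of \<kappa> r] by (simp add: power2_eq_square)
    have "?p \<in> model_space \<kappa>" "?x \<in> model_space \<kappa>"
      using m(1) cs_nonneg sq False by (auto intro!: memI simp: form)
    moreover have "\<kappa> * ((g * sn \<kappa> b) * (g * sn \<kappa> b) + (h * sn \<kappa> b) * (h * sn \<kappa> b))
        = \<kappa> * ((g * g + h * h) * (sn \<kappa> b * sn \<kappa> b))"
      by (simp add: algebra_simps)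
    then have "?y \<in> model_space \<kappa>"
      using m(1) cs_nonneg sq False by (auto intro!: memI simp: form gh)
    moreover have "model_dist \<kappa> ?p ?x = a" "model_dist \<kappa> ?p ?y = b"
      using False ab diam m(1) by (auto intro!: model_dist_eqI simp: form abc)
    moreover have "model_dist \<kappa> ?x ?y = c"
    proof (rule model_dist_eqI[OF False])
      have "cs \<kappa> c = cs \<kappa> (a + b) + \<kappa> * ((1 + g) * (sn \<kappa> a * sn \<kappa> b))"
        by (simp add: cs_def md_c algebra_simps)
      then show "\<kappa> * model_form \<kappa> ?x ?y = cs \<kappa> c"
        using m(1) unfolding form cs_add by (simp add: algebra_simps)
      show "\<kappa> > 0 \<longrightarrow> c \<le> pi / sqrt \<kappa>"
        using diam tri by (auto simp: perimeter_def abc)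
    qed (simp add: abc)
    ultimately have "comparison_triple \<kappa> p x y ?p ?x ?y"
      by (simp add: comparison_triple_def abc)
    then show ?thesis by blast
  qed
qed

lemma comparison_angle_eq:
  fixes p x y :: "'a::metric_space"
  assumes "p \<noteq> x" "p \<noteq> y"
    and diam: "\<kappa> > 0 \<longrightarrow>
      dist p x < pi / sqrt \<kappa> \<and> dist p y < pi / sqrt \<kappa> \<and> perimeter p x y \<le> 2 * (pi / sqrt \<kappa>)"
  shows "comparison_angle \<kappa> p x y = arccos (law_cos \<kappa> (dist p x) (dist p y) (dist x y))"
proof -
  have angle: "model_angle \<kappa> p' x' y' = arccos (law_cos \<kappa> (dist p x) (dist p y) (dist x y))"
    if "comparison_triple \<kappa> p x y p' x' y'" for p' x' y'
    using that model_angle_eq[of p' \<kappa> x' y'] assms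
    by (auto simp: comparison_triple_def within_diam_def)
  obtain p' x' y' where "comparison_triple \<kappa> p x y p' x' y'"
    using comparison_triple_exists[OF assms] by blast
  then show ?thesis unfolding comparison_angle_def
    by (intro the_equality) (use angle in \<open>auto intro!: exI\<close>)
qed

lemma law_cos_dist_bounds:
  fixes p x y :: "'a::metric_space"
  assumes "p \<noteq> x" "p \<noteq> y"
    and diam: "\<kappa> > 0 \<longrightarrow>
      dist p x < pi / sqrt \<kappa> \<and> dist p y < pi / sqrt \<kappa> \<and> perimeter p x y \<le> 2 * (pi / sqrt \<kappa>)"
  shows "\<bar>law_cos \<kappa> (dist p x) (dist p y) (dist x y)\<bar> \<le> 1"
  by (rule law_cos_bounds)
    (use assms dist_triangle3[of x y p] dist_triangle2[of p x y] dist_triangle[of p y x]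
      in \<open>auto simp: perimeter_def dist_commute\<close>)

section \<open>Segments and upper angles\<close>

text \<open>A form free of parametrizations: the distance from p is an isometric coordinate on S,
  and \<gamma> is its inverse. Subsegments can then be cut out by inequalities between distances
  from p.\<close>

lemma segment_iff:
  "segment p q S \<longleftrightarrow>
     p \<in> S \<and> q \<in> S \<and> dist p ` S = {0..dist p q} \<and>
     (\<forall>u\<in>S. \<forall>v\<in>S. dist u v = \<bar>dist p u - dist p v\<bar>)"
  (is "_ \<longleftrightarrow> ?R")
proof
  assume "segment p q S"
  then obtain \<gamma> where g:
    "\<And>s t. s \<in> {0..dist p q} \<Longrightarrow> t \<in> {0..dist p q} \<Longrightarrow> dist (\<gamma> s) (\<gamma> t) = \<bar>s - t\<bar>"
    "\<gamma> 0 = p" "\<gamma> (dist p q) = q" "S = \<gamma> ` {0..dist p q}"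
    unfolding segment_def by blast
  have par: "dist p (\<gamma> s) = s" if "s \<in> {0..dist p q}" for s
    using g(1)[of 0 s] g(2) that by auto
  have "dist p ` S = id ` {0..dist p q}"
    unfolding g(4) image_image by (rule image_cong) (auto simp: par)
  then have "dist p ` S = {0..dist p q}" by simp
  moreover have "\<gamma> 0 \<in> S" "\<gamma> (dist p q) \<in> S"
    unfolding g(4) by (rule imageI, simp)+
  then have "p \<in> S" "q \<in> S" unfolding g(2,3) .
  moreover have "dist u v = \<bar>dist p u - dist p v\<bar>" if uv: "u \<in> S" "v \<in> S" for u v
  proof -
    obtain s t where "u = \<gamma> s" "v = \<gamma> t" "s \<in> {0..dist p q}" "t \<in> {0..dist p q}"
      using uv unfolding g(4) by blast
    then show ?thesis by (simp only: par g(1))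
  qed
  ultimately show ?R by (intro conjI ballI)
next
  assume R: ?R
  then have im: "dist p ` S = {0..dist p q}" and pq: "p \<in> S" "q \<in> S"
    and dist_eq: "\<And>u v. u \<in> S \<Longrightarrow> v \<in> S \<Longrightarrow> dist u v = \<bar>dist p u - dist p v\<bar>" by blast+
  have "\<exists>\<gamma>. \<forall>s\<in>{0..dist p q}. \<gamma> s \<in> S \<and> dist p (\<gamma> s) = s"
    by (intro bchoice ballI) (auto simp flip: im)
  then obtain \<gamma> where g: "\<And>s. s \<in> {0..dist p q} \<Longrightarrow> \<gamma> s \<in> S" "\<And>s. s \<in> {0..dist p q} \<Longrightarrow> dist p (\<gamma> s) = s"
    by blast
  have eq: "\<gamma> (dist p z) = z" if "z \<in> S" for z
  proof -
    have r: "dist p z \<in> {0..dist p q}" using im that by blast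
    have "dist (\<gamma> (dist p z)) z = 0"
      unfolding dist_eq[OF g(1)[OF r] that] g(2)[OF r] by simp
    then show ?thesis by simp
  qed
  have "\<gamma> ` {0..dist p q} = S"
    unfolding im[symmetric] image_image by (simp add: eq cong: image_cong)
  moreover have "\<gamma> 0 = p" "\<gamma> (dist p q) = q" using eq[OF pq(1)] eq[OF pq(2)] by simp_all
  moreover have "dist (\<gamma> s) (\<gamma> t) = \<bar>s - t\<bar>" if "s \<in> {0..dist p q}" "t \<in> {0..dist p q}" for s t
    unfolding dist_eq[OF g(1)[OF that(1)] g(1)[OF that(2)]] g(2)[OF that(1)] g(2)[OF that(2)] ..
  ultimately show "segment p q S" unfolding segment_def by blast
qed

lemma segmentI:
  assumes "p \<in> S" "q \<in> S" "dist p ` S = {0..dist p q}"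
    and "\<And>u v. u \<in> S \<Longrightarrow> v \<in> S \<Longrightarrow> dist u v = \<bar>dist p u - dist p v\<bar>"
  shows "segment p q S"
  using assms unfolding segment_iff by blast

lemma segment_image: "segment p q S \<Longrightarrow> dist p ` S = {0..dist p q}"
  unfolding segment_iff by blast

lemma segment_dist:
  "segment p q S \<Longrightarrow> u \<in> S \<Longrightarrow> v \<in> S \<Longrightarrow> dist u v = \<bar>dist p u - dist p v\<bar>"
  unfolding segment_iff by blast

lemma segment_endpoints: "segment p q S \<Longrightarrow> p \<in> S" "segment p q S \<Longrightarrow> q \<in> S"
  unfolding segment_iff by blast+

lemma segment_dist_le: "segment p q S \<Longrightarrow> u \<in> S \<Longrightarrow> dist p u \<le> dist p q"
  using segment_image[of p q S] by auto

lemma segment_dist_end: "segment p q S \<Longrightarrow> u \<in> S \<Longrightarrow> dist u q = dist p q - dist p u"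
  using segment_dist[of p q S u q] segment_dist_le[of p q S u] segment_endpoints[of p q S] by simp

lemma segment_point:
  assumes "segment p q S" "0 \<le> t" "t \<le> dist p q"
  obtains z where "z \<in> S" "dist p z = t"
proof -
  have "t \<in> dist p ` S" unfolding segment_image[OF assms(1)] using assms by simp
  then show ?thesis using that by auto
qed

lemma segment_rev:
  assumes "segment p q S" shows "segment q p S"
proof -
  have d: "dist q u = dist p q - dist p u" if "u \<in> S" for u
    using segment_dist_end[OF assms that] by (simp add: dist_commute)
  have "dist q ` S = (\<lambda>r. dist p q - r) ` dist p ` S"
    unfolding image_image by (rule image_cong) (auto simp: d)
  also have "\<dots> = {0..dist q p}"
    unfolding segment_image[OF assms] by (simp add: image_diff_atLeastAtMost dist_commute)
  finally show ?thesis
  proof (rule segmentI[OF segment_endpoints(2,1)[OF assms]])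
    show "dist u v = \<bar>dist q u - dist q v\<bar>" if "u \<in> S" "v \<in> S" for u v
      using segment_dist[OF assms that] unfolding d[OF that(1)] d[OF that(2)] by simp
  qed
qed

lemma subsegment:
  assumes S: "segment p q S" and uv: "u \<in> S" "v \<in> S" "dist p u \<le> dist p v"
  shows "segment u v {z \<in> S. dist p u \<le> dist p z \<and> dist p z \<le> dist p v}" (is "segment _ _ ?U")
proof -
  have d: "dist u z = dist p z - dist p u" if "z \<in> ?U" for z
    using that segment_dist[OF S uv(1), of z] by auto
  have "dist u ` ?U = (\<lambda>z. dist p z - dist p u) ` ?U"
    by (rule image_cong) (auto simp: d)
  also have "\<dots> = {0..dist u v}"
  proof (intro equalityI subsetI)
    fix s assume s: "s \<in> {0..dist u v}"
    have "dist u v = dist p v - dist p u" using uv by (intro d) auto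
    then have "0 \<le> dist p u + s" "dist p u + s \<le> dist p q"
      using s segment_dist_le[OF S uv(2)] by auto
    then obtain z where "z \<in> S" "dist p z = dist p u + s" using segment_point[OF S] by metis
    then show "s \<in> (\<lambda>z. dist p z - dist p u) ` ?U"
      using s \<open>dist u v = dist p v - dist p u\<close> by (intro image_eqI[of _ _ z]) auto
  qed (use d[of v] uv in auto)
  finally show ?thesis
  proof (rule segmentI[rotated 2])
    show "dist z w = \<bar>dist u z - dist u w\<bar>" if "z \<in> ?U" "w \<in> ?U" for z w
      using segment_dist[OF S, of z w] that unfolding d[OF that(1)] d[OF that(2)] by simp
  qed (use uv in auto)
qed

text \<open>\<open>balanced_segment\<close> speaks of arbitrary subsegments contained in S. A point
  of S is determined by its distance from p, so such a subsegment is determined by its ends and can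
  be replaced by a concrete set.\<close>

lemma subsegment_unique:
  assumes S: "segment p q S" and uv: "u \<in> S" "v \<in> S" "dist p u \<le> dist p v"
    and U: "segment u v U" "U \<subseteq> S"
  shows "U = {z \<in> S. dist p u \<le> dist p z \<and> dist p z \<le> dist p v}"
proof (intro equalityI subsetI)
  have duv: "dist u v = dist p v - dist p u" using segment_dist[OF S uv(1,2)] uv(3) by simp
  {
    fix z assume z: "z \<in> U"
    have "dist u z = \<bar>dist p u - dist p z\<bar>" "dist z v = \<bar>dist p z - dist p v\<bar>"
      using uv z U(2) by (auto intro!: segment_dist[OF S])
    with segment_dist_end[OF U(1) z] duv
    show "z \<in> {z \<in> S. dist p u \<le> dist p z \<and> dist p z \<le> dist p v}" using z U(2) by auto
  } note sub = this
  fix z assume z: "z \<in> {z \<in> S. dist p u \<le> dist p z \<and> dist p z \<le> dist p v}"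
  then obtain w where w: "w \<in> U" "dist u w = dist p z - dist p u"
    using segment_point[OF U(1), of "dist p z - dist p u"] duv by auto
  have "dist u w = \<bar>dist p u - dist p w\<bar>" "dist z w = \<bar>dist p z - dist p w\<bar>"
    using uv w(1) z U(2) by (auto intro!: segment_dist[OF S])
  then have "dist z w = 0" using w sub[OF w(1)] by auto
  then show "z \<in> U" using w by simp
qed

text \<open>In a small ball around u both sets coincide. Upper angles at u depend only on this
  filter, so they do not change when a side is shortened.\<close>

lemma at_within_subsegment_right:
  assumes S: "segment p q S" and uv: "u \<in> S" "dist p u < dist p v"
    and U: "U \<subseteq> S" "{z \<in> S. dist p u \<le> dist p z \<and> dist p z \<le> dist p v} \<subseteq> U"
      "\<And>z. z \<in> U \<Longrightarrow> dist p u \<le> dist p z"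
  shows "at u within U = at u within {z \<in> S. dist p u \<le> dist p z}"
proof (rule at_within_nhd)
  show "u \<in> ball u (dist p v - dist p u)" "open (ball u (dist p v - dist p u))" using uv by auto
  have "dist p z \<le> dist p v" if "z \<in> S" "dist u z < dist p v - dist p u" for z
    using segment_dist[OF S uv(1) that(1)] that(2) by linarith
  then show "U \<inter> ball u (dist p v - dist p u) - {u} =
      {z \<in> S. dist p u \<le> dist p z} \<inter> ball u (dist p v - dist p u) - {u}"
    using U by auto
qed

lemma at_within_subsegment_left:
  assumes S: "segment p q S" and uv: "u \<in> S" "dist p v < dist p u"
    and U: "U \<subseteq> S" "{z \<in> S. dist p v \<le> dist p z \<and> dist p z \<le> dist p u} \<subseteq> U"
      "\<And>z. z \<in> U \<Longrightarrow> dist p z \<le> dist p u"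
  shows "at u within U = at u within {z \<in> S. dist p z \<le> dist p u}"
proof (rule at_within_nhd)
  show "u \<in> ball u (dist p u - dist p v)" "open (ball u (dist p u - dist p v))" using uv by auto
  have "dist p v \<le> dist p z" if "z \<in> S" "dist u z < dist p u - dist p v" for z
    using segment_dist[OF S uv(1) that(1)] that(2) by linarith
  then show "U \<inter> ball u (dist p u - dist p v) - {u} =
      {z \<in> S. dist p z \<le> dist p u} \<inter> ball u (dist p u - dist p v) - {u}"
    using U by auto
qed

section \<open>Balanced segments and bounds for upper angles\<close>

lemma upper_angle_cong:
  assumes "at p within S = at p within S'" "at p within T = at p within T'"
  shows "upper_angle \<kappa> p S T = upper_angle \<kappa> p S' T'"
  using assms by (simp add: upper_angle_def)

lemma balanced_segmentD1: "balanced_segment \<kappa> p q S \<Longrightarrow> segment p q S"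
  by (simp add: balanced_segment_def)

lemma balanced_segmentD2:
  "balanced_segment \<kappa> p x S \<Longrightarrow> q \<in> S \<Longrightarrow> q \<noteq> p \<Longrightarrow> q \<noteq> x \<Longrightarrow> q \<noteq> y \<Longrightarrow> segment q y T \<Longrightarrow>
    segment q p P \<Longrightarrow> P \<subseteq> S \<Longrightarrow> segment q x X \<Longrightarrow> X \<subseteq> S \<Longrightarrow>
    upper_angle \<kappa> q P T + upper_angle \<kappa> q X T = pi"
  unfolding balanced_segment_def by blast

lemma balanced_segment_rev:
  assumes "balanced_segment \<kappa> p x S" shows "balanced_segment \<kappa> x p S"
  unfolding balanced_segment_def
proof (intro conjI allI impI)
  show "segment x p S" using balanced_segmentD1[OF assms] by (rule segment_rev)
  fix q y T P X
  assume "q \<in> S - {x, p}" "q \<noteq> y" "segment q y T" "segment q x P" "P \<subseteq> S"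
    "segment q p X" "X \<subseteq> S"
  then have "upper_angle \<kappa> q X T + upper_angle \<kappa> q P T = pi"
    by (intro balanced_segmentD2[OF assms]) auto
  then show "upper_angle \<kappa> q P T + upper_angle \<kappa> q X T = pi" by simp
qed

lemma balanced_angle_sum:
  assumes B: "balanced_segment \<kappa> p q S" and r: "r \<in> S" "r \<noteq> p" "r \<noteq> q"
    and T: "segment r y T" "r \<noteq> y"
  shows "upper_angle \<kappa> r {z \<in> S. dist p z \<le> dist p r} T +
    upper_angle \<kappa> r {z \<in> S. dist p r \<le> dist p z} T = pi"
proof -
  note S = balanced_segmentD1[OF B]
  have "segment p r {z \<in> S. dist p z \<le> dist p r}"
    using subsegment[OF S segment_endpoints(1)[OF S] r(1)] by simp
  moreover have "segment r q {z \<in> S. dist p r \<le> dist p z}"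
    using subsegment[OF S r(1) segment_endpoints(2)[OF S] segment_dist_le[OF S r(1)]]
    by (rule back_subst[of "segment r q"]) (use segment_dist_le[OF S] in auto)
  ultimately show ?thesis
    using r T by (intro balanced_segmentD2[OF B]) (auto intro: segment_rev)
qed

text \<open>At an interior point r of the subsegment, its two parts agree near r with the two parts
  of S, so the angle sum is inherited from S.\<close>

lemma balanced_subsegment:
  assumes B: "balanced_segment \<kappa> p q S" and uv: "u \<in> S" "v \<in> S" "dist p u \<le> dist p v"
  shows "balanced_segment \<kappa> u v {z \<in> S. dist p u \<le> dist p z \<and> dist p z \<le> dist p v}"
    (is "balanced_segment _ _ _ ?U")
  unfolding balanced_segment_def
proof (intro conjI allI impI)
  note S = balanced_segmentD1[OF B]
  show "segment u v ?U" by (rule subsegment[OF S uv])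
  fix r y T P X
  assume r: "r \<in> ?U - {u, v}" and T: "r \<noteq> y" "segment r y T"
    and P: "segment r u P" "P \<subseteq> ?U" and X: "segment r v X" "X \<subseteq> ?U"
  have dists: "dist u r = dist p r - dist p u" "dist r v = dist p v - dist p r"
    using segment_dist[OF S, of u r] segment_dist[OF S, of r v] uv r by auto
  then have lt: "dist p u < dist p r" "dist p r < dist p v"
    using r by (metis DiffE insertCI zero_less_dist_iff diff_gt_0_iff_gt)+
  have Peq: "P = {z \<in> S. dist p u \<le> dist p z \<and> dist p z \<le> dist p r}"
    using subsegment_unique[OF S uv(1) _ _ segment_rev[OF P(1)]] r lt P(2) by auto
  have Xeq: "X = {z \<in> S. dist p r \<le> dist p z \<and> dist p z \<le> dist p v}"
    using subsegment_unique[OF S _ uv(2) _ X(1)] r lt X(2) by auto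
  have "r \<noteq> p" "r \<noteq> q" using lt segment_dist_le[OF S uv(2)] by (auto simp: not_less)
  then have "upper_angle \<kappa> r {z \<in> S. dist p z \<le> dist p r} T +
      upper_angle \<kappa> r {z \<in> S. dist p r \<le> dist p z} T = pi"
    using balanced_angle_sum[OF B] r T by auto
  moreover have "at r within P = at r within {z \<in> S. dist p z \<le> dist p r}"
    by (rule at_within_subsegment_left[OF S]) (use r lt Peq in auto)
  moreover have "at r within X = at r within {z \<in> S. dist p r \<le> dist p z}"
    by (rule at_within_subsegment_right[OF S]) (use r lt Xeq in auto)
  ultimately show "upper_angle \<kappa> r P T + upper_angle \<kappa> r X T = pi"
    by (metis upper_angle_cong)
qed

lemma at_within_segment_nontrivial:
  assumes "segment p q S" "p \<noteq> q"
  shows "at p within S \<noteq> bot"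
proof -
  have "\<exists>z\<in>S. z \<noteq> p \<and> dist z p < e" if "e > 0" for e
  proof -
    obtain z where "z \<in> S" "dist p z = min (e / 2) (dist p q)"
      using segment_point[OF assms(1), of "min (e / 2) (dist p q)"] \<open>e > 0\<close> by auto
    moreover have "0 < min (e / 2) (dist p q)" "min (e / 2) (dist p q) < e"
      using assms(2) \<open>e > 0\<close> by auto
    ultimately show ?thesis by (metis dist_commute dist_self less_irrefl)
  qed
  then show ?thesis by (auto simp: trivial_limit_within islimpt_approachable)
qed

lemma comparison_angle_commute: "comparison_angle \<kappa> p x y = comparison_angle \<kappa> p y x"
proof -
  have form: "model_form \<kappa> u v = model_form \<kappa> v u" for u v
    by (simp add: model_form_def mult.commute)
  have "comparison_triple \<kappa> p x y p' x' y' = comparison_triple \<kappa> p y x p' y' x'" for p' x' y'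
    by (auto simp: comparison_triple_def model_dist_def dist_commute form)
  moreover have "model_angle \<kappa> p' x' y' = model_angle \<kappa> p' y' x'" for p' x' y'
    by (simp add: model_angle_def Let_def form mult.commute)
  ultimately show ?thesis unfolding comparison_angle_def by metis
qed

lemma upper_angle_commute: "upper_angle \<kappa> p S T = upper_angle \<kappa> p T S"
proof -
  have "Limsup ((at p within S) \<times>\<^sub>F (at p within T)) (\<lambda>(u, v). ereal (comparison_angle \<kappa> p u v)) =
    Limsup ((at p within T) \<times>\<^sub>F (at p within S)) (\<lambda>z. case prod.swap z of (u, v) \<Rightarrow> ereal (comparison_angle \<kappa> p u v))"
    by (subst prod_filter_commute) (rule Limsup_filtermap_eq, simp)
  also have "(\<lambda>z. case prod.swap z of (u, v) \<Rightarrow> ereal (comparison_angle \<kappa> p u v)) =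
      (\<lambda>(u, v). ereal (comparison_angle \<kappa> p u v))"
    by (auto simp: comparison_angle_commute)
  finally show ?thesis by (simp add: upper_angle_def)
qed

text \<open>Near p all comparison angles are values of \<open>arccos\<close>, so the
  \<open>Limsup\<close> is finite and \<open>real_of_ereal\<close> returns its true value.\<close>

lemma upper_angle_bounds:
  fixes p :: "'a::metric_space"
  assumes "at p within S \<noteq> bot" "at p within T \<noteq> bot"
  shows "0 \<le> upper_angle \<kappa> p S T" "upper_angle \<kappa> p S T \<le> pi"
proof -
  let ?F = "(at p within S) \<times>\<^sub>F (at p within T)"
  let ?f = "\<lambda>(u, v). ereal (comparison_angle \<kappa> p u v)"
  \<comment> \<open>Two points closer to p than half of \<open>D_\<kappa>\<close> form with p a
    triple of perimeter less than twice \<open>D_\<kappa>\<close>, by the triangle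
    inequality.\<close>
  define e where "e = (if \<kappa> > 0 then pi / sqrt \<kappa> / 2 else 1)"
  have "e > 0" by (simp add: e_def)
  then have ev: "eventually (\<lambda>u. u \<noteq> p \<and> dist u p < e) (at p within R)" for R
    unfolding eventually_at by blast
  have "0 \<le> comparison_angle \<kappa> p u v \<and> comparison_angle \<kappa> p u v \<le> pi"
    if u: "u \<noteq> p \<and> dist u p < e" and v: "v \<noteq> p \<and> dist v p < e" for u v
  proof -
    have d: "\<kappa> > 0 \<longrightarrow> dist p u < pi / sqrt \<kappa> \<and> dist p v < pi / sqrt \<kappa> \<and>
        perimeter p u v \<le> 2 * (pi / sqrt \<kappa>)"
    proof
      assume "\<kappa> > 0"
      then have "e = pi / sqrt \<kappa> / 2" by (simp add: e_def)
      then show "dist p u < pi / sqrt \<kappa> \<and> dist p v < pi / sqrt \<kappa> \<and>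
          perimeter p u v \<le> 2 * (pi / sqrt \<kappa>)"
        using u v \<open>e > 0\<close> dist_triangle[of u v p] unfolding perimeter_def
        by (simp add: dist_commute)
    qed
    from u v have "p \<noteq> u" "p \<noteq> v" by auto
    from comparison_angle_eq[OF this d] law_cos_dist_bounds[OF this d] show ?thesis
      by (simp add: abs_le_iff arccos_lbound arccos_ubound)
  qed
  then have "eventually (\<lambda>z. 0 \<le> ?f z \<and> ?f z \<le> ereal pi) ?F"
    by (intro eventually_mono[OF eventually_prodI[OF ev ev]]) auto
  then have "0 \<le> Limsup ?F ?f" "Limsup ?F ?f \<le> ereal pi"
    using assms
    by (auto intro!: le_Limsup Limsup_bounded simp: prod_filter_eq_bot elim: eventually_mono)
  then show "0 \<le> upper_angle \<kappa> p S T" "upper_angle \<kappa> p S T \<le> pi"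
    unfolding upper_angle_def by (cases "Limsup ?F ?f"; simp)+
qed

section \<open>Hinges\<close>

lemma within_diam_mono: "within_diam \<kappa> t \<Longrightarrow> s \<le> t \<Longrightarrow> within_diam \<kappa> s"
  by (auto simp: within_diam_def)

lemma within_diam_half: "within_diam \<kappa> (r / 2) \<longleftrightarrow> (\<kappa> > 0 \<longrightarrow> r < 2 * (pi / sqrt \<kappa>))"
  unfolding within_diam_def by linarith

lemma side_le_half_perimeter:
  "dist p x \<le> perimeter p x y / 2" "dist p y \<le> perimeter p x y / 2" "dist x y \<le> perimeter p x y / 2"
  using dist_triangle[of p x y] dist_triangle[of p y x] dist_triangle3[of x y p]
  by (simp_all add: perimeter_def dist_commute)

lemma perimeter_commute: "perimeter p x y = perimeter p y x"
  by (simp add: perimeter_def dist_commute)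

lemma hinge_commute: "hinge p x y S T \<longleftrightarrow> hinge p y x T S"
  by (auto simp: hinge_def)

text \<open>\<open>cos\<close> is decreasing on the interval from 0 to \<open>pi\<close>, and the
  positive denominator of the cosine law can be cleared. The resulting inequality is affine in the
  cosine of the upper angle.\<close>

lemma angle_comparison_iff:
  fixes p x y :: "'a::metric_space"
  assumes H: "hinge p x y S T" and per: "within_diam \<kappa> (perimeter p x y / 2)"
  shows "angle_comparison \<kappa> p x y S T \<longleftrightarrow>
    md \<kappa> (dist x y) \<le> hinge_md \<kappa> (dist p x) (dist p y) (upper_angle \<kappa> p S T)"
proof -
  define a b c \<alpha> where abc: "a = dist p x" "b = dist p y" "c = dist x y" "\<alpha> = upper_angle \<kappa> p S T"
  have ne: "p \<noteq> x" "p \<noteq> y" and seg: "segment p x S" "segment p y T"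
    using H by (auto simp: hinge_def)
  have diam: "within_diam \<kappa> a" "within_diam \<kappa> b"
    using within_diam_mono[OF per side_le_half_perimeter(1)] within_diam_mono[OF per side_le_half_perimeter(2)]
    by (simp_all add: abc)
  have D: "\<kappa> > 0 \<longrightarrow>
      dist p x < pi / sqrt \<kappa> \<and> dist p y < pi / sqrt \<kappa> \<and> perimeter p x y \<le> 2 * (pi / sqrt \<kappa>)"
    using diam per unfolding within_diam_half
    by (auto simp: within_diam_def abc simp del: times_divide_eq_right)
  have pos: "0 < sn \<kappa> a * sn \<kappa> b" using ne diam by (intro mult_pos_pos sn_pos) (auto simp: abc)
  have L: "\<bar>law_cos \<kappa> a b c\<bar> \<le> 1" using law_cos_dist_bounds[OF ne D] by (simp add: abc)
  have \<alpha>: "0 \<le> \<alpha>" "\<alpha> \<le> pi"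
    using upper_angle_bounds[OF at_within_segment_nontrivial[OF seg(1) ne(1)]
        at_within_segment_nontrivial[OF seg(2) ne(2)]] by (simp_all add: abc)
  have "angle_comparison \<kappa> p x y S T \<longleftrightarrow> arccos (law_cos \<kappa> a b c) \<le> \<alpha>"
    using comparison_angle_eq[OF ne D] by (simp add: angle_comparison_def abc)
  also have "\<dots> \<longleftrightarrow> cos \<alpha> \<le> cos (arccos (law_cos \<kappa> a b c))"
    using \<alpha> L by (intro cos_mono_le_eq[symmetric]) (auto simp: arccos_lbound arccos_ubound abs_le_iff)
  also have "\<dots> \<longleftrightarrow> 1 + cos \<alpha> \<le> (md \<kappa> (a + b) - md \<kappa> c) / (sn \<kappa> a * sn \<kappa> b)"
    using L by (auto simp: abs_le_iff law_cos_def)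
  also have "\<dots> \<longleftrightarrow> (1 + cos \<alpha>) * (sn \<kappa> a * sn \<kappa> b) \<le> md \<kappa> (a + b) - md \<kappa> c"
    by (rule pos_le_divide_eq[OF pos])
  also have "\<dots> \<longleftrightarrow> md \<kappa> c \<le> hinge_md \<kappa> a b \<alpha>"
    unfolding hinge_md_def by (simp add: mult.commute mult.left_commute le_diff_eq add.commute)
  finally show ?thesis by (simp add: abc)
qed

section \<open>Subdividing a hinge at a point of a side\<close>

lemma balanced_initial_segment:
  assumes "balanced_segment \<kappa> q y B" "r \<in> B"
  shows "balanced_segment \<kappa> q r {z \<in> B. dist q z \<le> dist q r}"
  using balanced_subsegment[OF assms(1) segment_endpoints(1)[OF balanced_segmentD1[OF assms(1)]] assms(2)]
  by simp

lemma balanced_final_segment: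
  assumes "balanced_segment \<kappa> q y B" "r \<in> B"
  shows "balanced_segment \<kappa> r y {z \<in> B. dist q r \<le> dist q z}"
proof -
  note S = balanced_segmentD1[OF assms(1)]
  have "{z \<in> B. dist q r \<le> dist q z \<and> dist q z \<le> dist q y} = {z \<in> B. dist q r \<le> dist q z}"
    using segment_dist_le[OF S] by auto
  with balanced_subsegment[OF assms(1) assms(2) segment_endpoints(2)[OF S] segment_dist_le[OF S assms(2)]]
  show ?thesis by simp
qed

lemma at_within_initial_segment:
  assumes S: "segment q y B" and r: "r \<in> B" "r \<noteq> q"
  shows "at q within {z \<in> B. dist q z \<le> dist q r} = at q within B"
proof -
  have "at q within {z \<in> B. dist q z \<le> dist q r} = at q within {z \<in> B. dist q q \<le> dist q z}"
    by (rule at_within_subsegment_right[OF S segment_endpoints(1)[OF S], where v = r]) (use r in auto)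
  then show ?thesis by simp
qed

lemma perimeter_subhinge_le:
  assumes "segment q y B" "r \<in> B"
  shows "perimeter q x r \<le> perimeter q x y"
  using segment_dist_end[OF assms] dist_triangle[of x r y] by (simp add: perimeter_def dist_commute)

text \<open>\<open>c1\<close> bounds \<open>?h\<close> from below, which is the second claim.
  \<open>c2\<close> and balancedness at r bound \<open>?h'\<close> from above. By
  \<open>stewart\<close> the two bounds coincide, which gives the first claim. The second claim is
  kept because it measures how much the sum of the sides drops.\<close>

lemma hinge_md_subdivision:
  fixes q x y r :: "'a::metric_space" and A B A' :: "'a set" and \<kappa> :: real
  defines "a \<equiv> dist q x" and "b \<equiv> dist q y" and "t \<equiv> dist q r" and "c \<equiv> dist r x"
  assumes H: "hinge q x y A B" and B: "balanced_segment \<kappa> q y B"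
    and r: "r \<in> B" "r \<noteq> q" "r \<noteq> y" "r \<noteq> x" and A': "segment r x A'"
    and per: "within_diam \<kappa> (perimeter q x y / 2)"
    and c1: "angle_comparison \<kappa> q x r A {z \<in> B. dist q z \<le> dist q r}"
    and c2: "angle_comparison \<kappa> r x q A' {z \<in> B. dist q z \<le> dist q r}"
  shows "hinge_md \<kappa> c (b - t) (upper_angle \<kappa> r A' {z \<in> B. dist q r \<le> dist q z})
      \<le> hinge_md \<kappa> a b (upper_angle \<kappa> q A B)" (is "?h' \<le> ?h")
    and "sn \<kappa> t * md \<kappa> (a + b) - sn \<kappa> b * (md \<kappa> (a + t) - md \<kappa> c)
      \<le> sn \<kappa> t * hinge_md \<kappa> a b (upper_angle \<kappa> q A B)"
proof -
  let ?B1 = "{z \<in> B. dist q z \<le> dist q r}" and ?B2 = "{z \<in> B. dist q r \<le> dist q z}"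
  define \<alpha> \<phi> where "\<alpha> = upper_angle \<kappa> q A B" and "\<phi> = upper_angle \<kappa> r A' ?B1"
  note S = balanced_segmentD1[OF B]
  have ne: "q \<noteq> x" "q \<noteq> y" and A: "segment q x A" using H by (auto simp: hinge_def)
  have B1: "segment q r ?B1" by (rule balanced_segmentD1[OF balanced_initial_segment[OF B r(1)]])
  have per': "within_diam \<kappa> (perimeter q x r / 2)" "within_diam \<kappa> (perimeter r x q / 2)"
    using within_diam_mono[OF per] perimeter_subhinge_le[OF S r(1), of x]
    by (auto simp: perimeter_def dist_commute add.commute add.left_commute)
  have bt: "dist r y = b - t" unfolding b_def t_def by (rule segment_dist_end[OF S r(1)])
  have diam: "within_diam \<kappa> b" "within_diam \<kappa> t" "within_diam \<kappa> (b - t)"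
    using within_diam_mono[OF per side_le_half_perimeter(2)] within_diam_mono[OF per'(1) side_le_half_perimeter(2)]
    by (auto simp: b_def t_def intro: within_diam_mono)
  have pos: "0 < sn \<kappa> t" "0 \<le> sn \<kappa> b" "0 \<le> sn \<kappa> (b - t)"
    using r ne diam zero_less_dist_iff[of r y] unfolding bt
    by (auto intro!: sn_pos less_imp_le simp: t_def b_def)
  have "upper_angle \<kappa> q A ?B1 = \<alpha>"
    unfolding \<alpha>_def by (rule upper_angle_cong) (simp_all add: at_within_initial_segment[OF S r(1,2)])
  moreover have "hinge q x r A ?B1" using A B1 ne r by (auto simp: hinge_def)
  ultimately have 1: "md \<kappa> c \<le> md \<kappa> (a + t) - sn \<kappa> a * sn \<kappa> t * (1 + cos \<alpha>)"
    using c1 per'(1) by (simp add: angle_comparison_iff hinge_md_def a_def t_def c_def dist_commute)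
  have "hinge r x q A' ?B1" using A' segment_rev[OF B1] r by (auto simp: hinge_def)
  then have 2: "md \<kappa> a \<le> md \<kappa> (c + t) - sn \<kappa> c * sn \<kappa> t * (1 + cos \<phi>)"
    using c2 per'(2)
    by (simp add: angle_comparison_iff hinge_md_def a_def t_def c_def \<phi>_def dist_commute)
  have "\<phi> + upper_angle \<kappa> r A' ?B2 = pi"
    using balanced_angle_sum[OF B r(1-3) A' r(4)] by (simp add: \<phi>_def upper_angle_commute)
  then have "upper_angle \<kappa> r A' ?B2 = pi - \<phi>" by simp
  then have h': "?h' = md \<kappa> (c + (b - t)) - sn \<kappa> c * sn \<kappa> (b - t) * (1 - cos \<phi>)"
    by (simp add: hinge_md_def)
  have "sn \<kappa> b * (sn \<kappa> a * sn \<kappa> t * (1 + cos \<alpha>)) \<le> sn \<kappa> b * (md \<kappa> (a + t) - md \<kappa> c)"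
    using 1 pos(2) by (intro mult_left_mono) auto
  then show low: "sn \<kappa> t * md \<kappa> (a + b) - sn \<kappa> b * (md \<kappa> (a + t) - md \<kappa> c) \<le> sn \<kappa> t * ?h"
    by (simp add: hinge_md_def algebra_simps flip: \<alpha>_def)
  \<comment> \<open>This rewrites \<open>2\<close> with c - t in place of c + t, so that it contains
    1 - cos \<phi>, the term that the supplementary angle contributes to \<open>?h'\<close>.\<close>
  have "md \<kappa> (c + t) - md \<kappa> (c - t) = 2 * (sn \<kappa> c * sn \<kappa> t)"
    unfolding md_add md_diff by simp
  with 2 have "md \<kappa> a - md \<kappa> (c - t) \<le> sn \<kappa> c * sn \<kappa> t * (1 - cos \<phi>)"
    by (simp add: algebra_simps)
  then have "sn \<kappa> (b - t) * (md \<kappa> a - md \<kappa> (c - t)) \<le> sn \<kappa> (b - t) * (sn \<kappa> c * sn \<kappa> t * (1 - cos \<phi>))"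
    using pos(3) by (intro mult_left_mono)
  then have "sn \<kappa> t * ?h' \<le> sn \<kappa> t * md \<kappa> (c + (b - t)) - sn \<kappa> (b - t) * (md \<kappa> a - md \<kappa> (c - t))"
    unfolding h' by (simp add: algebra_simps)
  also have "\<dots> \<le> sn \<kappa> t * ?h" using low stewart[of \<kappa> t a b c] by simp
  finally show "?h' \<le> ?h" using pos(1) by simp
qed

section \<open>Descent by sliding the vertex of a hinge\<close>

lemma md_lipschitz:
  assumes "c \<le> d" "\<And>r. c \<le> r \<Longrightarrow> r \<le> d \<Longrightarrow> sn \<kappa> r \<le> K"
  shows "md \<kappa> d - md \<kappa> c \<le> K * (d - c)"
proof (cases "c = d")
  case False
  with assms(1) have "c < d" by simp
  from MVT2[OF this, of "md \<kappa>" "sn \<kappa>"] has_real_derivative_md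
  obtain z where "c < z" "z < d" "md \<kappa> d - md \<kappa> c = (d - c) * sn \<kappa> z" by blast
  then show ?thesis using assms(2)[of z] \<open>c < d\<close> by (simp add: mult.commute)
qed simp

text \<open>The assumption of the theorem on smaller hinges, with P and E kept fixed while the hinge
  under study varies. It is applied with P the perimeter of the original hinge and E the union of
  its sides.\<close>

definition small_hinges_comparable :: "real \<Rightarrow> real \<Rightarrow> 'a::metric_space set \<Rightarrow> bool" where
  "small_hinges_comparable \<kappa> P E \<longleftrightarrow>
     (\<forall>p x y S T. hinge p x y S T \<longrightarrow> balanced_segment \<kappa> p x S \<longrightarrow> balanced_segment \<kappa> p y T \<longrightarrow>
        perimeter p x y < 4/5 * P \<longrightarrow> {x, y} \<inter> E \<noteq> {} \<longrightarrow> angle_comparison \<kappa> p x y S T)"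

lemma small_hinges_comparableD:
  "small_hinges_comparable \<kappa> P E \<Longrightarrow> hinge p x y S T \<Longrightarrow>
    balanced_segment \<kappa> p x S \<Longrightarrow> balanced_segment \<kappa> p y T \<Longrightarrow>
    perimeter p x y < 4/5 * P \<Longrightarrow> x \<in> E \<or> y \<in> E \<Longrightarrow> angle_comparison \<kappa> p x y S T"
  unfolding small_hinges_comparable_def by blast

text \<open>The new vertex r lies on the longer side at distance t from q. Both auxiliary hinges
  have the endpoint x in E and perimeter at most 2 (a + t) \<le> s + 2 t. The sum of the sides drops
  by a + t - c, which the failure g of (A) bounds from below.\<close>

lemma cats_cradle_step:
  fixes q x y :: "'a::metric_space" and E :: "'a set" and \<kappa> P :: real
  assumes ex: "\<forall>a b :: 'a. within_diam \<kappa> (dist a b) \<longrightarrow> (\<exists>U. balanced_segment \<kappa> a b U)"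
    and small: "small_hinges_comparable \<kappa> P E"
    and x: "x \<in> E" and H: "hinge q x y A B"
    and A: "balanced_segment \<kappa> q x A" and B: "balanced_segment \<kappa> q y B"
    and per: "within_diam \<kappa> (perimeter q x y / 2)"
    and large: "4/5 * P \<le> perimeter q x y"
    and longer: "dist q x \<le> dist q y" and s: "dist q x + dist q y \<le> s"
    and t: "0 < t" "t \<le> P / 10" "s + 2 * t < 4/5 * P"
    and K: "0 < K" "\<forall>r\<in>{0..s}. sn \<kappa> r \<le> K"
    and g: "0 < g" "hinge_md \<kappa> (dist q x) (dist q y) (upper_angle \<kappa> q A B) \<le> md \<kappa> (dist x y) - g"
  shows "\<exists>r A' B'. hinge r x y A' B' \<and> balanced_segment \<kappa> r x A' \<and> balanced_segment \<kappa> r y B' \<and>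
    within_diam \<kappa> (perimeter r x y / 2) \<and>
    dist r x + dist r y \<le> dist q x + dist q y - g * sn \<kappa> t / K\<^sup>2 \<and>
    hinge_md \<kappa> (dist r x) (dist r y) (upper_angle \<kappa> r A' B')
      \<le> hinge_md \<kappa> (dist q x) (dist q y) (upper_angle \<kappa> q A B) \<and>
    0 < sn \<kappa> t"
proof -
  define a b d where abd: "a = dist q x" "b = dist q y" "d = dist x y"
  note S = balanced_segmentD1[OF B]
  have ne: "q \<noteq> x" "q \<noteq> y" using H by (auto simp: hinge_def)
  have tri: "d \<le> a + b" using dist_triangle2[of x y q] by (simp add: abd dist_commute)
  \<comment> \<open>The perimeter is at most 2 (a + b) \<le> 4 b, so b is at least P / 5.\<close>
  have "t < b" using large longer tri t unfolding perimeter_def abd by linarith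
  then obtain r where r: "r \<in> B" "dist q r = t" using segment_point[OF S, of t] t abd by auto
  have ry: "dist r y = b - t" using segment_dist_end[OF S r(1)] r(2) by (simp add: abd)
  have rne: "r \<noteq> q" "r \<noteq> y" using r(2) ry t \<open>t < b\<close> by auto
  have diam: "within_diam \<kappa> a" "within_diam \<kappa> b"
    using within_diam_mono[OF per side_le_half_perimeter(1)] within_diam_mono[OF per side_le_half_perimeter(2)]
    by (simp_all add: abd)
  \<comment> \<open>If the slide reached x, then x would lie on the side from q to y and d would be
    the least possible third side, so (A) could not fail.\<close>
  have rx: "r \<noteq> x"
  proof
    assume "r = x"
    then have "d = \<bar>a - b\<bar>" using ry r(2) \<open>t < b\<close> by (simp add: abd)
    then have "md \<kappa> d \<le> hinge_md \<kappa> a b (upper_angle \<kappa> q A B)"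
      using hinge_md_ge[of \<kappa> a b] sn_pos ne diam by (simp add: md_abs abd less_imp_le)
    with g show False by (simp add: abd)
  qed
  define c where "c = dist r x"
  have c: "c \<le> a + t" using dist_triangle2[of r x q] r(2) by (simp add: c_def abd dist_commute)
  let ?B1 = "{z \<in> B. dist q z \<le> dist q r}" and ?B2 = "{z \<in> B. dist q r \<le> dist q z}"
  have per_r: "perimeter q x r \<le> perimeter q x y" by (rule perimeter_subhinge_le[OF S r(1)])
  then have "within_diam \<kappa> c"
    using within_diam_mono[OF per] side_le_half_perimeter(3)[of x r q] by (simp add: c_def dist_commute)
  then obtain A' where A': "balanced_segment \<kappa> r x A'" using ex c_def by blast
  note B1 = balanced_initial_segment[OF B r(1)] and B2 = balanced_final_segment[OF B r(1)]
  have short: "perimeter q x r < 4/5 * P" "perimeter r x q < 4/5 * P"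
    using c s t longer r(2) by (simp_all add: perimeter_def c_def abd dist_commute)
  have c1: "angle_comparison \<kappa> q x r A ?B1"
    using small_hinges_comparableD[OF small _ A B1 short(1)] x ne rne balanced_segmentD1[OF A] balanced_segmentD1[OF B1]
    by (simp add: hinge_def)
  have c2: "angle_comparison \<kappa> r x q A' ?B1"
    using small_hinges_comparableD[OF small _ A' balanced_segment_rev[OF B1] short(2)] x rx rne
      balanced_segmentD1[OF A'] segment_rev[OF balanced_segmentD1[OF B1]]
    by (simp add: hinge_def)
  note sub = hinge_md_subdivision[OF H B r(1) rne rx balanced_segmentD1[OF A'] per c1 c2,
      unfolded r(2), folded abd c_def]
  have snt: "0 < sn \<kappa> t" using t \<open>t < b\<close> diam(2) by (intro sn_pos) (auto intro: within_diam_mono)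
  \<comment> \<open>Since d \<le> a + b, the gap g turns the second claim of the subdivision into a
    lower bound for \<open>md \<kappa> (a + t) - md \<kappa> c\<close>, and the Lipschitz bound K
    converts this into one for a + t - c.\<close>
  have "md \<kappa> d \<le> md \<kappa> (a + b)"
    using tri per unfolding within_diam_half
    by (intro md_mono) (auto simp: perimeter_def abd simp del: times_divide_eq_right)
  then have "sn \<kappa> t * md \<kappa> d \<le> sn \<kappa> t * md \<kappa> (a + b)" using snt by simp
  moreover have "sn \<kappa> t * hinge_md \<kappa> a b (upper_angle \<kappa> q A B) \<le> sn \<kappa> t * (md \<kappa> d - g)"
    using g(2) snt by (simp add: abd)
  ultimately have "sn \<kappa> t * g \<le> sn \<kappa> b * (md \<kappa> (a + t) - md \<kappa> c)"
    using sub(2) by (simp add: algebra_simps)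
  also have "\<dots> \<le> K * (md \<kappa> (a + t) - md \<kappa> c)"
  proof (rule mult_right_mono)
    have "a + t + c \<le> perimeter q x y" using per_r r(2) by (simp add: perimeter_def abd c_def dist_commute)
    then have "md \<kappa> c \<le> md \<kappa> (a + t)"
      using c per unfolding within_diam_half
      by (intro md_mono) (auto simp: c_def simp del: times_divide_eq_right)
    then show "0 \<le> md \<kappa> (a + t) - md \<kappa> c" by simp
    have "0 \<le> b" "b \<le> s" using s zero_le_dist[of q x] zero_le_dist[of q y] unfolding abd by linarith+
    then show "sn \<kappa> b \<le> K" using K(2) by simp
  qed
  also have "\<dots> \<le> K * (K * (a + t - c))"
  proof (intro mult_left_mono md_lipschitz)
    fix r' assume "c \<le> r'" "r' \<le> a + t"
    moreover have "0 \<le> c" "a + t \<le> s" using s \<open>t < b\<close> by (simp_all add: c_def abd)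
    ultimately have "r' \<in> {0..s}" by simp
    then show "sn \<kappa> r' \<le> K" using K(2) by blast
  qed (use c K(1) in auto)
  finally have "g * sn \<kappa> t / K\<^sup>2 \<le> a + t - c"
    using K(1) by (simp add: divide_le_eq power2_eq_square mult_ac)
  then have dec: "dist r x + dist r y \<le> dist q x + dist q y - g * sn \<kappa> t / K\<^sup>2"
    using ry by (simp add: c_def abd)
  moreover have "0 \<le> g * sn \<kappa> t / K\<^sup>2" using g(1) snt by simp
  ultimately have "perimeter r x y \<le> perimeter q x y" unfolding perimeter_def by linarith
  then have "within_diam \<kappa> (perimeter r x y / 2)" using within_diam_mono[OF per] by simp
  moreover have "hinge r x y A' ?B2"
    using rx rne balanced_segmentD1[OF A'] balanced_segmentD1[OF B2] by (simp add: hinge_def)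
  ultimately show ?thesis
    using sub(1) r(2) A' B2 dec snt by (intro exI[of _ r] exI[of _ A'] exI[of _ ?B2]) (simp add: abd c_def ry)
qed


lemma cats_cradle:
  fixes q u v :: "'a::metric_space" and E :: "'a set" and \<kappa> P :: real
  assumes ex: "\<forall>a b :: 'a. within_diam \<kappa> (dist a b) \<longrightarrow> (\<exists>U. balanced_segment \<kappa> a b U)"
    and small: "small_hinges_comparable \<kappa> P E"
    and uv: "u \<in> E" "v \<in> E" and H: "hinge q u v A B"
    and A: "balanced_segment \<kappa> q u A" and B: "balanced_segment \<kappa> q v B"
    and per: "within_diam \<kappa> (perimeter q u v / 2)"
    and sum: "dist q u + dist q v < 4/5 * P"
  shows "angle_comparison \<kappa> q u v A B"
proof (rule ccontr)
  assume contra: "\<not> ?thesis"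
  define s where "s = dist q u + dist q v"
  \<comment> \<open>The second term gives s + 2 t \<le> s / 2 + 2/5 P, which is less than 4/5
    P.\<close>
  define t where "t = min (P / 10) (P / 5 - s / 4)"
  define g where "g = md \<kappa> (dist u v) - hinge_md \<kappa> (dist q u) (dist q v) (upper_angle \<kappa> q A B)"
  have "0 \<le> s" "s < 4/5 * P" using sum by (simp_all add: s_def)
  then have "0 < t" by (simp add: t_def)
  moreover have "t \<le> P / 10" "t \<le> P / 5 - s / 4"
    unfolding t_def by (rule min.cobounded1, rule min.cobounded2)
  moreover from this(2) \<open>s < 4/5 * P\<close> have "s + 2 * t < 4/5 * P" by linarith
  ultimately have t: "0 < t" "t \<le> P / 10" "s + 2 * t < 4/5 * P" by blast+
  have g: "0 < g" using contra angle_comparison_iff[OF H per] by (simp add: g_def)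
  have "compact (sn \<kappa> ` {0..s})"
    by (intro compact_continuous_image continuous_on_sn) simp
  then obtain K0 where K0: "\<And>z. z \<in> sn \<kappa> ` {0..s} \<Longrightarrow> norm z \<le> K0"
    using compact_imp_bounded bounded_iff by metis
  define K where "K = max K0 1"
  have K: "0 < K" "\<forall>r\<in>{0..s}. sn \<kappa> r \<le> K"
    using K0 by (force simp: K_def)+
  define \<delta> where "\<delta> = g * sn \<kappa> t / K\<^sup>2"
  \<comment> \<open>The invariant of the descent: u, v, the gap g and the bound s are fixed by the
    initial hinge, and only the vertex and the sides vary. Hence t, K and \<delta> serve for all
    steps.\<close>
  define bad where "bad q A B \<longleftrightarrow> hinge q u v A B \<and> balanced_segment \<kappa> q u A \<and>
    balanced_segment \<kappa> q v B \<and> within_diam \<kappa> (perimeter q u v / 2) \<and> dist q u + dist q v \<le> s \<and>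
    hinge_md \<kappa> (dist q u) (dist q v) (upper_angle \<kappa> q A B) \<le> md \<kappa> (dist u v) - g" for q A B
  \<comment> \<open>The claim includes 0 < \<delta>, because the positivity of
    \<open>sn \<kappa> t\<close> is obtained from a hinge with a side longer than t.\<close>
  have step: "\<exists>q' A' B'. bad q' A' B' \<and> 0 < \<delta> \<and> dist q' u + dist q' v \<le> dist q u + dist q v - \<delta>"
    if "bad q A B" for q A B
  proof -
    have b: "hinge q u v A B" "balanced_segment \<kappa> q u A" "balanced_segment \<kappa> q v B"
      "within_diam \<kappa> (perimeter q u v / 2)" "dist q u + dist q v \<le> s"
      "hinge_md \<kappa> (dist q u) (dist q v) (upper_angle \<kappa> q A B) \<le> md \<kappa> (dist u v) - g"
      using that by (simp_all add: bad_def)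
    \<comment> \<open>(A) fails for a bad hinge, so it cannot be one of the small hinges; its large
      perimeter leaves room for the slide.\<close>
    have "\<not> angle_comparison \<kappa> q u v A B"
      using angle_comparison_iff[OF b(1,4)] b(6) g by simp
    then have large: "4/5 * P \<le> perimeter q u v"
      using small_hinges_comparableD[OF small b(1-3)] uv by (cases "perimeter q u v < 4/5 * P") simp_all
    show ?thesis
    proof (cases "dist q u \<le> dist q v")
      case True
      from cats_cradle_step[OF ex small uv(1) b(1-4) large True b(5) t K g b(6)]
      obtain q' A' B' where "hinge q' u v A' B'" "balanced_segment \<kappa> q' u A'" "balanced_segment \<kappa> q' v B'"
        "within_diam \<kappa> (perimeter q' u v / 2)" "dist q' u + dist q' v \<le> dist q u + dist q v - \<delta>"
        "hinge_md \<kappa> (dist q' u) (dist q' v) (upper_angle \<kappa> q' A' B')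
          \<le> hinge_md \<kappa> (dist q u) (dist q v) (upper_angle \<kappa> q A B)" "0 < sn \<kappa> t"
        unfolding \<delta>_def by blast
      moreover from this have "0 < \<delta>" using g K(1) by (simp add: \<delta>_def)
      ultimately have "bad q' A' B' \<and> 0 < \<delta> \<and> dist q' u + dist q' v \<le> dist q u + dist q v - \<delta>"
        using b(5,6) by (simp add: bad_def)
      then show ?thesis by blast
    next
      case False
      then have "dist q v \<le> dist q u" by simp
      from cats_cradle_step[OF ex small uv(2) b(1)[THEN hinge_commute[THEN iffD1]] b(3,2)
          b(4)[unfolded perimeter_commute[of q u v]] large[unfolded perimeter_commute[of q u v]] this
          b(5)[unfolded add.commute[of "dist q u"]] t K g
          b(6)[unfolded hinge_md_commute[of \<kappa> "dist q u"] upper_angle_commute[of \<kappa> q A] dist_commute[of u v]]]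
      obtain q' A' B' where "hinge q' v u A' B'" "balanced_segment \<kappa> q' v A'" "balanced_segment \<kappa> q' u B'"
        "within_diam \<kappa> (perimeter q' v u / 2)" "dist q' v + dist q' u \<le> dist q v + dist q u - \<delta>"
        "hinge_md \<kappa> (dist q' v) (dist q' u) (upper_angle \<kappa> q' A' B')
          \<le> hinge_md \<kappa> (dist q v) (dist q u) (upper_angle \<kappa> q B A)" "0 < sn \<kappa> t"
        unfolding \<delta>_def by blast
      moreover from this have "0 < \<delta>" using g K(1) by (simp add: \<delta>_def)
      ultimately have "bad q' B' A' \<and> 0 < \<delta> \<and> dist q' u + dist q' v \<le> dist q u + dist q v - \<delta>"
        using b(5,6) hinge_commute[of q' u v] perimeter_commute[of q' u v]
          hinge_md_commute[of \<kappa> "dist q' u" "dist q' v"] upper_angle_commute[of \<kappa> q' A' B']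
          hinge_md_commute[of \<kappa> "dist q u" "dist q v"] upper_angle_commute[of \<kappa> q A B]
        by (simp add: bad_def)
      then show ?thesis by blast
    qed
  qed
  \<comment> \<open>Each step uses up \<delta> of the sum of the sides, and a vanishing sum would
    force q = u.\<close>
  have descent: "\<not> bad q A B" if "dist q u + dist q v \<le> real n * \<delta>" for n q A B
    using that
  proof (induction n arbitrary: q A B)
    case 0
    then have "dist q u + dist q v \<le> 0" by simp
    then have "dist q u = 0" using zero_le_dist[of q u] zero_le_dist[of q v] by linarith
    then show ?case by (simp add: bad_def hinge_def)
  next
    case (Suc n)
    show ?case
    proof
      assume "bad q A B"
      then obtain q' A' B' where "bad q' A' B'" "dist q' u + dist q' v \<le> dist q u + dist q v - \<delta>"
        using step by blast
      moreover from this(2) Suc.prems have "dist q' u + dist q' v \<le> real n * \<delta>"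
        by (simp add: algebra_simps)
      ultimately show False using Suc.IH by blast
    qed
  qed
  have bad: "bad q A B" using H A B per by (simp add: bad_def s_def g_def)
  then have "0 < \<delta>" using step by blast
  then obtain n where "s < real n * \<delta>" using reals_Archimedean3 by blast
  with descent[of q n A B] bad show False by (simp add: s_def)
qed

text \<open>With r at distance P / 5 from p on the shorter side, the side sums of the hinges at p to
  y and r, at r to y and p, and at r to y and x are at most 7/10 P, 7/10 P and 3/5 P. The descent
  therefore applies to all three, and subdivision at r combines them.\<close>

lemma comparison_of_large_hinge:
  fixes p x y :: "'a::metric_space" and E :: "'a set" and \<kappa> P :: real
  defines "P \<equiv> perimeter p x y"
  assumes ex: "\<forall>a b :: 'a. within_diam \<kappa> (dist a b) \<longrightarrow> (\<exists>U. balanced_segment \<kappa> a b U)"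
    and small: "small_hinges_comparable \<kappa> P E"
    and H: "hinge p x y S T" and S: "balanced_segment \<kappa> p x S" and T: "balanced_segment \<kappa> p y T"
    and E: "S \<subseteq> E" "T \<subseteq> E"
    and per: "within_diam \<kappa> (P / 2)"
    and shorter: "dist p x \<le> dist p y" and large: "4/5 * P \<le> dist p x + dist p y"
  shows "angle_comparison \<kappa> p x y S T"
proof -
  note cradle = cats_cradle[OF ex small]
  note seg = balanced_segmentD1[OF S] balanced_segmentD1[OF T]
  have ne: "p \<noteq> x" "p \<noteq> y" using H by (auto simp: hinge_def)
  have P: "P = dist p x + dist p y + dist x y" by (simp add: P_def perimeter_def)
  have half: "dist p x \<le> P / 2" "dist p y \<le> P / 2"
    unfolding P_def by (rule side_le_half_perimeter)+
  have "0 < dist p x" using ne by simp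
  then have "0 < P" using half by linarith
  \<comment> \<open>Each side is at most P / 2, and together they have length at least 4/5
    P.\<close>
  have sides: "3/10 * P \<le> dist p x" "3/10 * P \<le> dist p y" using large half by auto
  obtain r where r: "r \<in> S" "dist p r = P / 5"
    using segment_point[OF seg(1), of "P / 5"] sides \<open>0 < P\<close> by auto
  have rx: "dist r x = dist p x - P / 5" using segment_dist_end[OF seg(1) r(1)] r(2) by simp
  have ry: "dist r y \<le> dist p x - P / 5 + dist x y" using dist_triangle[of r y x] rx by simp
  have ry0: "P / 10 \<le> dist r y" using dist_triangle[of p y r] r(2) sides by simp
  have rne: "r \<noteq> p" "r \<noteq> x" "r \<noteq> y" using r(2) rx ry0 sides \<open>0 < P\<close> by auto
  have inE: "p \<in> E" "x \<in> E" "y \<in> E" "r \<in> E"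
    using E r(1) segment_endpoints[OF seg(1)] segment_endpoints[OF seg(2)] by auto
  let ?S1 = "{z \<in> S. dist p z \<le> dist p r}" and ?S2 = "{z \<in> S. dist p r \<le> dist p z}"
  note S1 = balanced_initial_segment[OF S r(1)] and S2 = balanced_final_segment[OF S r(1)]
  \<comment> \<open>For the third hinge, \<open>large\<close> gives a distance of at most P / 5
    between x and y, so its perimeter is at most twice the length of the shorter side.\<close>
  have pers: "perimeter p y r \<le> P" "perimeter r y p \<le> P" "perimeter r y x \<le> P"
    unfolding perimeter_def dist_commute[of y r] dist_commute[of r p] dist_commute[of y x] dist_commute[of y p]
    using ry rx r(2) \<open>0 < P\<close> shorter large P by linarith+
  then have diam: "within_diam \<kappa> (perimeter p y r / 2)" "within_diam \<kappa> (perimeter r y p / 2)"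
      "within_diam \<kappa> (perimeter r y x / 2)"
    by (auto intro: within_diam_mono[OF per])
  have "within_diam \<kappa> (dist r y)"
    using side_le_half_perimeter(1)[of r y x] within_diam_mono[OF diam(3)] by simp
  then obtain A where A: "balanced_segment \<kappa> r y A" using ex by blast
  note segA = balanced_segmentD1[OF A]
  have hinges: "hinge p y r T ?S1" "hinge r y p A ?S1" "hinge r y x A ?S2"
    using ne rne seg segA balanced_segmentD1[OF S1] segment_rev[OF balanced_segmentD1[OF S1]]
      balanced_segmentD1[OF S2] by (auto simp: hinge_def)
  have c1: "angle_comparison \<kappa> p y r T ?S1"
    using r(2) half \<open>0 < P\<close> by (intro cradle[OF inE(3,4) hinges(1) T S1 diam(1)]) auto
  have "dist r y + dist r p < 4/5 * P"
    unfolding dist_commute[of r p] using ry r(2) sides \<open>0 < P\<close> P by linarith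
  then have c2: "angle_comparison \<kappa> r y p A ?S1"
    by (rule cradle[OF inE(3,1) hinges(2) A balanced_segment_rev[OF S1] diam(2)])
  have "dist r y + dist r x < 4/5 * P"
    using ry rx shorter \<open>0 < P\<close> P by linarith
  then have c3: "angle_comparison \<kappa> r y x A ?S2"
    by (rule cradle[OF inE(3,2) hinges(3) A S2 diam(3)])
  have "md \<kappa> (dist y x) \<le> hinge_md \<kappa> (dist r y) (dist r x) (upper_angle \<kappa> r A ?S2)"
    using c3 angle_comparison_iff[OF hinges(3) diam(3)] by simp
  \<comment> \<open>The subdivided side is the one from p to x, so the subdivision lemma is used
    with x and y exchanged.\<close>
  also have "\<dots> \<le> hinge_md \<kappa> (dist p y) (dist p x) (upper_angle \<kappa> p T S)"
    using hinge_md_subdivision(1)[OF hinge_commute[THEN iffD1, OF H] S r(1) rne(1,2,3) segA _ c1 c2]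
      per segment_dist_end[OF seg(1) r(1)] perimeter_commute[of p x y] by (simp add: P_def)
  finally show ?thesis
    using angle_comparison_iff[OF H per[unfolded P_def]]
    by (simp add: dist_commute hinge_md_commute upper_angle_commute)
qed

lemma angle_comparison_commute:
  "angle_comparison \<kappa> p x y S T \<longleftrightarrow> angle_comparison \<kappa> p y x T S"
  unfolding angle_comparison_def
  by (simp add: comparison_angle_commute[of \<kappa> p x y] upper_angle_commute[of \<kappa> p S T])

theorem proposition2p2:
  fixes \<kappa> :: real and p x y :: "'a::metric_space" and S T :: "'a set"
  assumes "\<And>a b :: 'a. ereal (dist a b) < model_diameter \<kappa> \<Longrightarrow> \<exists>U. balanced_segment \<kappa> a b U"
    and "hinge p x y S T"
    and "balanced_segment \<kappa> p x S" and "balanced_segment \<kappa> p y T"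
    and "ereal (perimeter p x y) < 2 * model_diameter \<kappa>"
    and "\<And>p' x' y' S' T'.
           hinge p' x' y' S' T' \<Longrightarrow>
           balanced_segment \<kappa> p' x' S' \<Longrightarrow> balanced_segment \<kappa> p' y' T' \<Longrightarrow>
           perimeter p' x' y' < 4/5 * perimeter p x y \<Longrightarrow>
           {x', y'} \<inter> (S \<union> T) \<noteq> {} \<Longrightarrow>
           angle_comparison \<kappa> p' x' y' S' T'"
  shows "angle_comparison \<kappa> p x y S T"
proof -
  have ex: "\<forall>a b :: 'a. within_diam \<kappa> (dist a b) \<longrightarrow> (\<exists>U. balanced_segment \<kappa> a b U)"
    using assms(1) by (auto simp: within_diam_def model_diameter_def)
  have per: "within_diam \<kappa> (perimeter p x y / 2)"
    using assms(5) unfolding within_diam_half by (auto simp: model_diameter_def)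
  have small: "small_hinges_comparable \<kappa> (perimeter p x y) (S \<union> T)"
    using assms(6) unfolding small_hinges_comparable_def by blast
  \<comment> \<open>In the first case the descent applies to the hinge itself; the other two differ
    by exchanging x and y.\<close>
  consider "dist p x + dist p y < 4/5 * perimeter p x y"
    | "4/5 * perimeter p x y \<le> dist p x + dist p y" "dist p x \<le> dist p y"
    | "4/5 * perimeter p x y \<le> dist p x + dist p y" "dist p y \<le> dist p x"
    by linarith
  then show ?thesis
  proof cases
    case 1
    have "x \<in> S \<union> T" "y \<in> S \<union> T"
      using segment_endpoints(2) balanced_segmentD1 assms(3,4) by blast+
    from cats_cradle[OF ex small this assms(2-4) per 1] show ?thesis .
  next
    case 2
    show ?thesis
      by (rule comparison_of_large_hinge[OF ex small assms(2-4) Un_upper1 Un_upper2 per 2(2,1)])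
  next
    case 3
    have "angle_comparison \<kappa> p y x T S"
      using 3 per unfolding perimeter_commute[of p x y]
      by (intro comparison_of_large_hinge[OF ex small[unfolded perimeter_commute[of p x y]] assms(2)[THEN hinge_commute[THEN iffD1]]
            assms(4,3) Un_upper2 Un_upper1]) (auto simp: add.commute)
    then show ?thesis by (simp add: angle_comparison_commute)
  qed
qed

end
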